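(* For any fixed $P_{U|X}$ and reconstruction function $g_n:\mathcal{U}^n\times\mathcal{Y}^n\to\hat{\mathcal{S}}^n\times\hat{\mathcal{X}}^n$, there exists an $(n,M_n,D,D_s,\varepsilon)$-code for the indirect Wyner-Ziv source coding problem such that $$\varepsilon\le\mathbb{E}\Big[1-\mathbf{1}\big[d_s(S,\hat S)\le D_s\ \cap\ d(X,\hat X)\le D\big]\times\Big(1+M_n^{-1}\,2^{\iota(U;X)-\iota(U;Y)}\Big)^{-1}\Big],$$ given that $P_{UX}\ll P_U\times P_X$ and $P_{UY}\ll P_U\times P_Y$.
   Context: Source model: $\vec S,\vec X,\vec Y$ are length-$n$ sequences with $(S_i,X_i,Y_i)$ i.i.d. with distribution $P_{SXY}$ on $\mathcal{S}\times\mathcal{X}\times\mathcal{Y}$. The encoder observes $\vec X$ only; $\vec Y$ is side information available only at the decoder; the latent $\vec S$ is observed by neither. $d_s:\mathcal{S}\times\hat{\mathcal{S}}\to[0,\infty)$ and $d:\mathcal{X}\times\hat{\mathcal{X}}\to[0,\infty)$ are per-letter distortion measures, with $\hat{\mathcal{S}},\hat{\mathcal{X}}$ the reconstruction alphabets; sequence distortions are $d_{n,s}(\vec s,\hat{\vec s})=\frac1n\sum_{i=1}^n d_s(s_i,\hat s_i)$ and $d_n(\vec x,\hat{\vec x})=\frac1n\sum_{i=1}^n d(x_i,\hat x_i)$. An $(n,M_n,D,D_s,\varepsilon)$-Wyner-Ziv code for indirect source coding, with $M_n=2^{nR}$ ($R$ being the coding rate), consists of an encoding function $\phi_n:\mathcal{X}^n\to\{1,\dots,M_n\}$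 and a (possibly randomized) decoding function $\{1,\dots,M_n\}\times\mathcal{Y}^n\to\hat{\mathcal{S}}^n\times\hat{\mathcal{X}}^n$ such that the reconstructions $(\hat{\vec S},\hat{\vec X})$ output by the decoder from $(\phi_n(\vec X),\vec Y)$ satisfy $$\mathbb{P}\big[(d_{n,s}(\vec S,\hat{\vec S})\ge D_s)\cup(d_n(\vec X,\hat{\vec X})\ge D)\big]\le\varepsilon .$$ The bound is written in one-shot notation: $(S,X,Y)$ is the source triple, $U$ is an auxiliary random variable, with values in the Polish space $\mathcal{U}$ (with its Borel $\sigma$-algebra), generated from $X$ through $P_{U|X}$ (so the joint law is $P_{SXY}P_{U|X}$), $(\hat S,\hat X)$ is the output of the reconstruction function applied to $U$ and $Y$, and the expectation is over all these variables. $P_{UX},P_{UY},P_U,P_X,P_Y$ are the corresponding marginals, and $\ll$ denotes absolute continuity. Information density: for a joint probability measure $P_{AB}$, $\iota(a;b)=\log_2\frac{dP_{B|A=a}}{dP_B}(b)$, the logarithm of the Radon-Nikodym derivative at $b$ of the conditional measure $P_{B|A=a}$ with respect to $P_B$. $\mathbf{1}[\cdot]$ is the indicator function, and $\cap$ inside it means that both conditions hold.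
   Formalization: As stated the claim fails when a distortion equals its threshold: the code counts ≥ as an error, the bound counts ≤ as success. Both consistent versions are proved: ≥ as error with < in the bound, and > as error with ≤ in the bound. *)

theory Defs
  imports "HOL-Probability.Probability"
begin

section \<open>Information density\<close>

text \<open>
  \<open>\<kappa>\<close> is (a version of) the conditional law \<open>P\<^bsub>B|A=a\<^esub>\<close> of the joint law \<open>P\<close> on the product of the
  measurable spaces \<open>A\<close> and \<open>B\<close>. Only the \<open>\<sigma>\<close>-algebras of \<open>A\<close> and \<open>B\<close> matter.
\<close>

definition regular_cond_dist ::
    "'a measure \<Rightarrow> 'b measure \<Rightarrow> ('a \<times> 'b) measure \<Rightarrow> ('a \<Rightarrow> 'b measure) \<Rightarrow> bool" where
  "regular_cond_dist A B P \<kappa> \<longleftrightarrow>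
     \<kappa> \<in> A \<rightarrow>\<^sub>M prob_algebra B \<and>
     (\<forall>E\<in>sets A. \<forall>F\<in>sets B.
        emeasure P (E \<times> F) = (\<integral>\<^sup>+ a\<in>E. emeasure (\<kappa> a) F \<partial>distr P A fst))"

text \<open>
  \<open>f (a, b)\<close> is a version of the Radon-Nikodym derivative at \<open>b\<close> of \<open>P\<^bsub>B|A=a\<^esub>\<close> with respect to
  \<open>P\<^sub>B\<close>. The versions for the different \<open>a\<close> have to be chosen such that \<open>f\<close> is jointly measurable:
  with \<open>RN_deriv (distr P B snd) (\<kappa> a) b\<close>, which selects a version for each \<open>a\<close> separately, the
  information density need not be a random variable.
\<close>

definition is_cond_RN_deriv ::
    "'a measure \<Rightarrow> 'b measure \<Rightarrow> ('a \<times> 'b) measure \<Rightarrow> ('a \<times> 'b \<Rightarrow> ennreal) \<Rightarrow> bool" where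
  "is_cond_RN_deriv A B P f \<longleftrightarrow>
     f \<in> borel_measurable (A \<Otimes>\<^sub>M B) \<and>
     (\<exists>\<kappa>. regular_cond_dist A B P \<kappa> \<and>
        (AE a in distr P A fst. density (distr P B snd) (\<lambda>b. f (a, b)) = \<kappa> a))"

definition cond_RN_deriv ::
    "'a measure \<Rightarrow> 'b measure \<Rightarrow> ('a \<times> 'b) measure \<Rightarrow> 'a \<times> 'b \<Rightarrow> ennreal" where
  "cond_RN_deriv A B P = (SOME f. is_cond_RN_deriv A B P f)"

text \<open>
  The values \<open>0\<close> and \<open>\<infinity>\<close> of the derivative, on which \<open>log 2 (enn2real _)\<close> is \<open>0\<close>, have \<open>P\<close>-measure
  zero.
\<close>

definition info_density ::
    "'a measure \<Rightarrow> 'b measure \<Rightarrow> ('a \<times> 'b) measure \<Rightarrow> 'a \<Rightarrow> 'b \<Rightarrow> real" where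
  "info_density A B P a b = log 2 (enn2real (cond_RN_deriv A B P (a, b)))"

text \<open>
  Existence of \<open>cond_RN_deriv\<close> under absolute continuity, and uniqueness up to null sets: the versions
  are joint densities.
\<close>

lemma ex_is_cond_RN_deriv:
  assumes "prob_space P" and sets_P: "sets P = sets (A \<Otimes>\<^sub>M B)"
    and ac: "absolutely_continuous (distr P A fst \<Otimes>\<^sub>M distr P B snd) P"
  shows "\<exists>f. is_cond_RN_deriv A B P f"
proof -
  define PA PB where "PA = distr P A fst" and "PB = distr P B snd"
  have [measurable_cong]: "sets P = sets (A \<Otimes>\<^sub>M B)" "sets PA = sets A" "sets PB = sets B"
    by (simp_all add: sets_P PA_def PB_def)
  interpret P: prob_space P by fact
  interpret A: prob_space PA unfolding PA_def by (rule P.prob_space_distr) measurable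
  interpret B: prob_space PB unfolding PB_def by (rule P.prob_space_distr) measurable
  interpret AB: pair_prob_space PA PB ..
  have sets_AB: "sets (PA \<Otimes>\<^sub>M PB) = sets (A \<Otimes>\<^sub>M B)"
    by (rule sets_pair_measure_cong) (simp_all add: PA_def PB_def)
  define f0 where "f0 = RN_deriv (PA \<Otimes>\<^sub>M PB) P"
  have [measurable]: "f0 \<in> borel_measurable (A \<Otimes>\<^sub>M B)"
    using borel_measurable_RN_deriv[of "PA \<Otimes>\<^sub>M PB" P]
    unfolding f0_def by (simp cong: measurable_cong_sets add: sets_AB)
  have dens: "density (PA \<Otimes>\<^sub>M PB) f0 = P"
    unfolding f0_def
    by (rule AB.density_RN_deriv) (use ac in \<open>simp_all add: PA_def PB_def sets_AB sets_P\<close>)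
  have rect: "emeasure P (E \<times> F) =
      (\<integral>\<^sup>+ a. (\<integral>\<^sup>+ b. f0 (a, b) * indicator F b \<partial>PB) * indicator E a \<partial>PA)"
    if [measurable]: "E \<in> sets A" "F \<in> sets B" for E F
  proof -
    have "emeasure P (E \<times> F) = (\<integral>\<^sup>+ z. f0 z * indicator (E \<times> F) z \<partial>(PA \<Otimes>\<^sub>M PB))"
      unfolding dens[symmetric] by (rule emeasure_density) measurable
    also have "\<dots> = (\<integral>\<^sup>+ a. \<integral>\<^sup>+ b. f0 (a, b) * indicator (E \<times> F) (a, b) \<partial>PB \<partial>PA)"
      by (rule B.nn_integral_fst[symmetric]) measurable
    also have "\<dots> = (\<integral>\<^sup>+ a. (\<integral>\<^sup>+ b. f0 (a, b) * indicator F b \<partial>PB) * indicator E a \<partial>PA)"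
      by (intro nn_integral_cong) (auto simp: indicator_times split: split_indicator)
    finally show ?thesis .
  qed
  define h where "h a = (\<integral>\<^sup>+ b. f0 (a, b) \<partial>PB)" for a
  have [measurable]: "h \<in> borel_measurable A"
    unfolding h_def by measurable
  have "density PA h = density PA (\<lambda>_. 1)"
  proof (rule measure_eqI)
    fix E assume "E \<in> sets (density PA h)"
    then have [measurable]: "E \<in> sets A" by (simp add: PA_def)
    have "emeasure (density PA h) E = (\<integral>\<^sup>+ a. h a * indicator E a \<partial>PA)"
      by (rule emeasure_density) measurable
    also have "\<dots> = (\<integral>\<^sup>+ a. (\<integral>\<^sup>+ b. f0 (a, b) * indicator (space B) b \<partial>PB) * indicator E a \<partial>PA)"
      unfolding h_def
      by (intro nn_integral_cong arg_cong2[where f = "(*)"] refl) (auto simp: PB_def)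
    also have "\<dots> = emeasure P (E \<times> space B)"
      by (rule rect[symmetric]) measurable
    also have "\<dots> = emeasure PA E"
    proof -
      have "fst -` E \<inter> space P = E \<times> space B"
        using sets.sets_into_space[of E A] sets_eq_imp_space_eq[OF sets_P]
        by (auto simp: space_pair_measure)
      then show ?thesis unfolding PA_def by (subst emeasure_distr) simp_all
    qed
    finally show "emeasure (density PA h) E = emeasure (density PA (\<lambda>_. 1)) E"
      by (simp add: density_1)
  qed simp
  then have h1: "AE a in PA. h a = 1"
    by (subst (asm) A.density_unique_iff) (auto simp: density_1 A.sigma_finite_measure_axioms)
  define f where "f = (\<lambda>(a, b). if h a = 1 then f0 (a, b) else 1)"
  define \<kappa> where "\<kappa> a = density PB (\<lambda>b. f (a, b))" for a
  have [measurable]: "f \<in> borel_measurable (A \<Otimes>\<^sub>M B)"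
    unfolding f_def by measurable
  have \<kappa>_emeasure: "emeasure (\<kappa> a) F = (\<integral>\<^sup>+ b. f (a, b) * indicator F b \<partial>PB)"
    if [measurable]: "a \<in> space A" "F \<in> sets B" for a F
    unfolding \<kappa>_def by (rule emeasure_density) measurable
  have prob: "prob_space (\<kappa> a)" if "a \<in> space A" for a
  proof (rule prob_spaceI)
    have "emeasure (\<kappa> a) (space B) = (\<integral>\<^sup>+ b. f (a, b) \<partial>PB)"
      unfolding \<kappa>_emeasure[OF that sets.top] by (intro nn_integral_cong) (simp add: PB_def)
    also have "\<dots> = 1"
      using B.emeasure_space_1 by (cases "h a = 1") (simp_all add: f_def, simp add: h_def)
    finally show "emeasure (\<kappa> a) (space (\<kappa> a)) = 1"
      by (simp add: \<kappa>_def PB_def)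
  qed
  have "\<kappa> \<in> A \<rightarrow>\<^sub>M prob_algebra B"
  proof (rule measurable_prob_algebraI, rule prob, assumption, rule measurable_subprob_algebra)
    show "subprob_space (\<kappa> a)" if "a \<in> space A" for a
      using prob[OF that] by (rule prob_space_imp_subprob_space)
    show "sets (\<kappa> a) = sets B" for a by (simp add: \<kappa>_def PB_def)
    fix F assume [measurable]: "F \<in> sets B"
    show "(\<lambda>a. emeasure (\<kappa> a) F) \<in> borel_measurable A"
      by (subst measurable_cong[OF \<kappa>_emeasure]) measurable
  qed
  moreover have "emeasure P (E \<times> F) = (\<integral>\<^sup>+ a\<in>E. emeasure (\<kappa> a) F \<partial>PA)"
    if [measurable]: "E \<in> sets A" "F \<in> sets B" for E F
  proof -
    have "AE a in PA. (\<integral>\<^sup>+ b. f0 (a, b) * indicator F b \<partial>PB) * indicator E a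
        = emeasure (\<kappa> a) F * indicator E a"
      using h1 AE_space by eventually_elim (simp add: \<kappa>_emeasure f_def PA_def)
    then show ?thesis unfolding rect[OF that] by (rule nn_integral_cong_AE)
  qed
  ultimately have "regular_cond_dist A B P \<kappa>"
    by (simp add: regular_cond_dist_def PA_def)
  then show ?thesis
    unfolding is_cond_RN_deriv_def
    by (intro exI[of _ f] conjI exI[of _ \<kappa>]) (simp_all add: \<kappa>_def PB_def)
qed

lemma is_cond_RN_deriv_density:
  assumes "prob_space P" and sets_P: "sets P = sets (A \<Otimes>\<^sub>M B)" and f: "is_cond_RN_deriv A B P f"
  shows "density (distr P A fst \<Otimes>\<^sub>M distr P B snd) f = P"
proof -
  define PA PB where "PA = distr P A fst" and "PB = distr P B snd"
  have [measurable_cong]: "sets P = sets (A \<Otimes>\<^sub>M B)" "sets PA = sets A" "sets PB = sets B"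
    by (simp_all add: sets_P PA_def PB_def)
  interpret P: prob_space P by fact
  interpret A: prob_space PA unfolding PA_def by (rule P.prob_space_distr) measurable
  interpret B: prob_space PB unfolding PB_def by (rule P.prob_space_distr) measurable
  interpret AB: pair_prob_space PA PB ..
  have sets_AB: "sets (PA \<Otimes>\<^sub>M PB) = sets (A \<Otimes>\<^sub>M B)"
    by (rule sets_pair_measure_cong) (simp_all add: PA_def PB_def)
  have [measurable]: "f \<in> borel_measurable (A \<Otimes>\<^sub>M B)"
    using f by (simp add: is_cond_RN_deriv_def)
  obtain \<kappa> where \<kappa>: "regular_cond_dist A B P \<kappa>"
      "AE a in PA. density PB (\<lambda>b. f (a, b)) = \<kappa> a"
    using f unfolding is_cond_RN_deriv_def PA_def PB_def by blast
  have rect: "emeasure (density (PA \<Otimes>\<^sub>M PB) f) (E \<times> F) = emeasure P (E \<times> F)"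
    if [measurable]: "E \<in> sets A" "F \<in> sets B" for E F
  proof -
    have "emeasure (density (PA \<Otimes>\<^sub>M PB) f) (E \<times> F) =
        (\<integral>\<^sup>+ z. f z * indicator (E \<times> F) z \<partial>(PA \<Otimes>\<^sub>M PB))"
      by (rule emeasure_density) measurable
    also have "\<dots> = (\<integral>\<^sup>+ a. \<integral>\<^sup>+ b. f (a, b) * indicator (E \<times> F) (a, b) \<partial>PB \<partial>PA)"
      by (rule B.nn_integral_fst[symmetric]) measurable
    also have "\<dots> = (\<integral>\<^sup>+ a. (\<integral>\<^sup>+ b. f (a, b) * indicator F b \<partial>PB) * indicator E a \<partial>PA)"
      by (intro nn_integral_cong) (auto simp: indicator_times split: split_indicator)
    also have "\<dots> = (\<integral>\<^sup>+ a\<in>E. emeasure (\<kappa> a) F \<partial>PA)"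
    proof (rule nn_integral_cong_AE)
      show "AE a in PA. (\<integral>\<^sup>+ b. f (a, b) * indicator F b \<partial>PB) * indicator E a
          = emeasure (\<kappa> a) F * indicator E a"
        using \<kappa>(2) AE_space
      proof eventually_elim
        fix a assume a: "density PB (\<lambda>b. f (a, b)) = \<kappa> a" "a \<in> space PA"
        then have [measurable]: "a \<in> space A" by (simp add: PA_def)
        have "emeasure (density PB (\<lambda>b. f (a, b))) F = (\<integral>\<^sup>+ b. f (a, b) * indicator F b \<partial>PB)"
          by (rule emeasure_density) measurable
        then show "(\<integral>\<^sup>+ b. f (a, b) * indicator F b \<partial>PB) * indicator E a
          = emeasure (\<kappa> a) F * indicator E a"
          by (simp add: a)
      qed
    qed
    also have "\<dots> = emeasure P (E \<times> F)"
      using \<kappa>(1) that by (simp add: regular_cond_dist_def PA_def)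
    finally show ?thesis .
  qed
  let ?G = "{E \<times> F | E F. E \<in> sets A \<and> F \<in> sets B}"
  have space_P: "space P = space A \<times> space B"
    using sets_eq_imp_space_eq[OF sets_P] by (simp add: space_pair_measure)
  have "density (PA \<Otimes>\<^sub>M PB) f = P"
  proof (rule measure_eqI_generator_eq[OF Int_stable_pair_measure_generator,
        where A = "\<lambda>_. space A \<times> space B"])
    show "?G \<subseteq> Pow (space A \<times> space B)"
      by (rule pair_measure_closed)
    show "emeasure (density (PA \<Otimes>\<^sub>M PB) f) Z = emeasure P Z" if "Z \<in> ?G" for Z
      using that rect by auto
    show "sets (density (PA \<Otimes>\<^sub>M PB) f) = sigma_sets (space A \<times> space B) ?G"
      unfolding sets_density sets_AB by (rule sets_pair_measure)
    show "sets P = sigma_sets (space A \<times> space B) ?G"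
      by (simp add: sets_P sets_pair_measure)
    show "emeasure (density (PA \<Otimes>\<^sub>M PB) f) (space A \<times> space B) \<noteq> \<infinity>"
      using P.emeasure_space_1 by (subst rect) (simp_all add: space_P)
  qed auto
  then show ?thesis by (simp add: PA_def PB_def)
qed

section \<open>Indirect Wyner-Ziv coding\<close>

text \<open>Length-\<open>n\<close> sequences are functions on the index set \<open>{0, \<dots>, n - 1}\<close>.\<close>

definition seq_space :: "nat \<Rightarrow> 'a measure \<Rightarrow> (nat \<Rightarrow> 'a) measure" where
  "seq_space n A = Pi\<^sub>M {..<n} (\<lambda>_. A)"

definition seq_dist :: "nat \<Rightarrow> ('a \<Rightarrow> 'b \<Rightarrow> real) \<Rightarrow> (nat \<Rightarrow> 'a) \<Rightarrow> (nat \<Rightarrow> 'b) \<Rightarrow> real" where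
  "seq_dist n d a b = (\<Sum>i<n. d (a i) (b i)) / real n"

text \<open>The law of the three source sequences when the triples \<open>(S\<^sub>i, X\<^sub>i, Y\<^sub>i)\<close> are i.i.d. with law \<open>P\<close>.\<close>

definition source_law ::
    "nat \<Rightarrow> 's measure \<Rightarrow> 'x measure \<Rightarrow> 'y measure \<Rightarrow> ('s \<times> 'x \<times> 'y) measure \<Rightarrow>
     ((nat \<Rightarrow> 's) \<times> (nat \<Rightarrow> 'x) \<times> (nat \<Rightarrow> 'y)) measure" where
  "source_law n S X Y P =
     distr (seq_space n P) (seq_space n S \<Otimes>\<^sub>M seq_space n X \<Otimes>\<^sub>M seq_space n Y)
       (\<lambda>\<omega>. (\<lambda>i\<in>{..<n}. fst (\<omega> i),
             \<lambda>i\<in>{..<n}. fst (snd (\<omega> i)),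
             \<lambda>i\<in>{..<n}. snd (snd (\<omega> i))))"

text \<open>
  The joint law of source, side information and reconstructions for the encoder \<open>\<phi>\<close> and the
  randomized decoder (stochastic kernel) \<open>\<psi>\<close>.
\<close>

definition code_law ::
    "nat \<Rightarrow> 's measure \<Rightarrow> 'x measure \<Rightarrow> 'y measure \<Rightarrow> 'sh measure \<Rightarrow> 'xh measure \<Rightarrow>
     ('s \<times> 'x \<times> 'y) measure \<Rightarrow> ((nat \<Rightarrow> 'x) \<Rightarrow> nat) \<Rightarrow>
     (nat \<times> (nat \<Rightarrow> 'y) \<Rightarrow> ((nat \<Rightarrow> 'sh) \<times> (nat \<Rightarrow> 'xh)) measure) \<Rightarrow>
     ((nat \<Rightarrow> 's) \<times> (nat \<Rightarrow> 'x) \<times> (nat \<Rightarrow> 'y) \<times> (nat \<Rightarrow> 'sh) \<times> (nat \<Rightarrow> 'xh)) measure" where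
  "code_law n S X Y Sh Xh P \<phi> \<psi> =
     source_law n S X Y P \<bind> (\<lambda>(s, x, y).
     \<psi> (\<phi> x, y) \<bind> (\<lambda>(sh, xh).
     return (seq_space n S \<Otimes>\<^sub>M seq_space n X \<Otimes>\<^sub>M seq_space n Y \<Otimes>\<^sub>M seq_space n Sh \<Otimes>\<^sub>M seq_space n Xh)
       (s, x, y, sh, xh)))"

text \<open>
  \<open>(\<phi>, \<psi>)\<close> is an \<open>(n, M, D, D\<^sub>s, \<epsilon>)\<close> code. The relation \<open>exceeds\<close> is the comparison, \<open>\<ge>\<close> or \<open>>\<close>, that
  counts as excess distortion; a bound on \<open>\<epsilon>\<close> has to count the complementary event (\<open><\<close> or \<open>\<le>\<close>) as
  success, since a distortion may equal its threshold with positive probability. The rate of the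
  code is \<open>log 2 M / n\<close>.
\<close>

definition wyner_ziv_code ::
    "(real \<Rightarrow> real \<Rightarrow> bool) \<Rightarrow>
     's measure \<Rightarrow> 'x measure \<Rightarrow> 'y measure \<Rightarrow> 'sh measure \<Rightarrow> 'xh measure \<Rightarrow>
     ('s \<times> 'x \<times> 'y) measure \<Rightarrow> ('s \<Rightarrow> 'sh \<Rightarrow> real) \<Rightarrow> ('x \<Rightarrow> 'xh \<Rightarrow> real) \<Rightarrow>
     nat \<Rightarrow> nat \<Rightarrow> real \<Rightarrow> real \<Rightarrow> real \<Rightarrow>
     ((nat \<Rightarrow> 'x) \<Rightarrow> nat) \<Rightarrow>
     (nat \<times> (nat \<Rightarrow> 'y) \<Rightarrow> ((nat \<Rightarrow> 'sh) \<times> (nat \<Rightarrow> 'xh)) measure) \<Rightarrow> bool" where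
  "wyner_ziv_code exceeds S X Y Sh Xh P ds d n M D Ds \<epsilon> \<phi> \<psi> \<longleftrightarrow>
     \<phi> \<in> seq_space n X \<rightarrow>\<^sub>M count_space {1..M} \<and>
     \<psi> \<in> count_space {1..M} \<Otimes>\<^sub>M seq_space n Y \<rightarrow>\<^sub>M
           prob_algebra (seq_space n Sh \<Otimes>\<^sub>M seq_space n Xh) \<and>
     \<P>((s, x, y, sh, xh) in code_law n S X Y Sh Xh P \<phi> \<psi>.
        exceeds (seq_dist n ds s sh) Ds \<or> exceeds (seq_dist n d x xh) D) \<le> \<epsilon>"

text \<open>
  The joint law \<open>P\<^bsub>SXY\<^esub>P\<^bsub>U|X\<^esub>\<close> of the source sequences and an auxiliary sequence, generated from
  the \<open>X\<close>-sequence by the kernel \<open>K\<close>.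
\<close>

definition aux_law ::
    "nat \<Rightarrow> 's measure \<Rightarrow> 'x measure \<Rightarrow> 'y measure \<Rightarrow> 'u measure \<Rightarrow>
     ('s \<times> 'x \<times> 'y) measure \<Rightarrow> ((nat \<Rightarrow> 'x) \<Rightarrow> (nat \<Rightarrow> 'u) measure) \<Rightarrow>
     ((nat \<Rightarrow> 's) \<times> (nat \<Rightarrow> 'x) \<times> (nat \<Rightarrow> 'y) \<times> (nat \<Rightarrow> 'u)) measure" where
  "aux_law n S X Y U P K =
     source_law n S X Y P \<bind> (\<lambda>(s, x, y).
     K x \<bind> (\<lambda>u.
     return (seq_space n S \<Otimes>\<^sub>M seq_space n X \<Otimes>\<^sub>M seq_space n Y \<Otimes>\<^sub>M seq_space n U) (s, x, y, u)))"

end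

theory Submission
  imports Defs
begin

text \<open>
  This is the argument of the Poisson matching lemma, with a finite codebook in place of the Poisson
  process. The codebook consists of \<open>N\<close> independent points \<open>(u\<^sub>k, m\<^sub>k, t\<^sub>k)\<close> with law
  \<open>P\<^sub>U \<times> unif {1..M} \<times> Exp(1)\<close>. With \<open>f = dP\<^bsub>U|X=x\<^esub>/dP\<^sub>U\<close> and \<open>g = dP\<^bsub>U|Y=y\<^esub>/dP\<^sub>U\<close>, the encoder takes
  the point minimizing \<open>t\<^sub>k / f u\<^sub>k\<close> and sends its \<open>m\<^sub>k\<close>; the decoder takes the point minimizing
  \<open>t\<^sub>k / g u\<^sub>k\<close> among those with the received message. By independence and Jensen's inequality, both
  choose a given point \<open>(u, m, t)\<close> with probability at least \<open>exp (- (N - 1) t A)\<close>, where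
  \<open>A = 1 / f u + (1 / g u - \<delta>) / M\<close> and \<open>\<delta> = \<integral> min (f v / f u) (g v / g u) dP\<^sub>U(v)\<close>. Hence the
  probability of success is at least the integral of \<open>N / (1 + (N - 1) A)\<close> over the good triples
  \<open>((s, x, y), u)\<close> under \<open>P\<^bsub>SXY\<^esub> \<times> P\<^sub>U\<close>, while the claimed bound is the integral of
  \<open>1 / (1 / f u + 1 / (M g u))\<close>. Since \<open>\<delta> > 0\<close> almost everywhere, the limit \<open>1 / A\<close> of the former
  integrand strictly exceeds the latter one, so that by Fatou's lemma the bound is reached exactly
  for some finite \<open>N\<close>, and then for some realization of the codebook.
\<close>

section \<open>Exponential races\<close>

text \<open>The index \<open>j\<close> minimizing \<open>T j / w j\<close>, cross-multiplied so that no division by a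
  zero weight occurs. If there is no strict minimizer the value is \<open>N - 1\<close>.\<close>

definition race :: "nat \<Rightarrow> (nat \<Rightarrow> real) \<Rightarrow> (nat \<Rightarrow> real) \<Rightarrow> nat" where
  "race N w T = (LEAST j. N \<le> Suc j \<or> (\<forall>k<N. k \<noteq> j \<longrightarrow> T j * w k < T k * w j))"

text \<open>The default disjunct of \<open>race\<close> holds at \<open>N - 1\<close>, which
  therefore bounds the least index.\<close>

lemma race_less: "0 < N \<Longrightarrow> race N w T < N"
proof -
  assume "0 < N"
  then have "race N w T \<le> N - 1"
    unfolding race_def by (intro Least_le) auto
  with \<open>0 < N\<close> show ?thesis by simp
qed

text \<open>Strict minimizers are unique, and the default disjunct only holds from
  \<open>N - 1\<close> on, so no index below \<open>j\<close> qualifies.\<close>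

lemma race_eq:
  assumes "j < N" and j: "\<And>k. k < N \<Longrightarrow> k \<noteq> j \<Longrightarrow> T j * w k < T k * w j"
  shows "race N w T = j"
  unfolding race_def
proof (rule Least_equality)
  fix i assume i: "N \<le> Suc i \<or> (\<forall>k<N. k \<noteq> i \<longrightarrow> T i * w k < T k * w i)"
  show "j \<le> i"
  proof (rule ccontr)
    assume "\<not> j \<le> i"
    with i \<open>j < N\<close> have "T i * w j < T j * w i" by auto
    moreover have "T j * w i < T i * w j"
      using j[of i] \<open>j < N\<close> \<open>\<not> j \<le> i\<close> by auto
    ultimately show False by simp
  qed
qed (use j in auto)

section \<open>The standard exponential law\<close>

abbreviation exp_law :: "real measure" where
  "exp_law \<equiv> density lborel (exponential_density 1)"

lemma emeasure_exp_law_greaterThan: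
  assumes "0 \<le> s"
  shows "emeasure exp_law {s<..} = ennreal (exp (- s))"
proof -
  interpret prob_space exp_law by (rule prob_space_exponential_density) simp
  have "distributed exp_law lborel (\<lambda>x. x) (exponential_density 1)"
    unfolding distributed_def by (auto simp: distr_id2)
  from exponential_distributedD_gt[OF this assms] show ?thesis
    by (simp add: emeasure_eq_measure greaterThan_def)
qed

text \<open>Multiplied by the density of \<open>exp_law\<close>, the integrand is
  \<open>1 / (1 + a)\<close> times the exponential density of rate \<open>1 + a\<close>, which has
  total mass one. The indicator is kept because the bound on winning is only available for
  nonnegative times.\<close>

lemma nn_integral_exp_law_exp:
  assumes "0 \<le> a"
  shows "(\<integral>\<^sup>+ t. indicator {0..} t * ennreal (exp (- t * a)) \<partial>exp_law) = ennreal (1 / (1 + a))"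
proof -
  interpret prob_space "density lborel (exponential_density (1 + a))"
    by (rule prob_space_exponential_density) (use assms in simp)
  have "(\<integral>\<^sup>+ t. indicator {0..} t * ennreal (exp (- t * a)) \<partial>exp_law) =
      (\<integral>\<^sup>+ t. ennreal (1 / (1 + a)) * ennreal (exponential_density (1 + a) t) \<partial>lborel)"
    using assms
    by (subst nn_integral_density)
      (auto intro!: nn_integral_cong
        simp: exponential_density_def indicator_def ennreal_mult'[symmetric] exp_add[symmetric] field_simps)
  also have "\<dots> = ennreal (1 / (1 + a)) * emeasure (density lborel (exponential_density (1 + a)))
      (space (density lborel (exponential_density (1 + a))))"
    by (simp add: nn_integral_cmult emeasure_density)
  finally show ?thesis by (simp only: emeasure_space_1) simp
qed

section \<open>A code point against its random rivals\<close>

abbreviation code_point_law :: "'u measure \<Rightarrow> nat \<Rightarrow> ('u \<times> nat \<times> real) measure" where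
  "code_point_law U M \<equiv> U \<Otimes>\<^sub>M uniform_count_measure {1..M} \<Otimes>\<^sub>M exp_law"

text \<open>The weight of the decoder vanishes on code points whose message differs from the one received.\<close>

definition beats ::
    "('u \<Rightarrow> real) \<Rightarrow> ('u \<Rightarrow> real) \<Rightarrow> 'u \<times> nat \<times> real \<Rightarrow> 'u \<times> nat \<times> real \<Rightarrow> bool" where
  "beats f g z z' \<longleftrightarrow>
     snd (snd z) * f (fst z') < snd (snd z') * f (fst z) \<and>
     snd (snd z) * (if fst (snd z') = fst (snd z) then g (fst z') else 0) < snd (snd z') * g (fst z)"

text \<open>What would be counted twice if the encoder's and the decoder's losses were added instead
  of taking their maximum at a rival with the same message.\<close>

definition overlap :: "'u measure \<Rightarrow> ('u \<Rightarrow> real) \<Rightarrow> ('u \<Rightarrow> real) \<Rightarrow> 'u \<Rightarrow> real" where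
  "overlap U f g u = (\<integral>v. min (f v / f u) (g v / g u) \<partial>U)"

text \<open>For a code point at \<open>u\<close>, this is the mean over a rival \<open>(v, l)\<close> of
  \<open>max (f v / f u) ([l = m] * g v / g u)\<close>, by \<open>max a b = a + b - min a b\<close> and the normalization of \<open>f\<close>
  and \<open>g\<close>.\<close>

definition loss_rate :: "'u measure \<Rightarrow> nat \<Rightarrow> ('u \<Rightarrow> real) \<Rightarrow> ('u \<Rightarrow> real) \<Rightarrow> 'u \<Rightarrow> real" where
  "loss_rate U M f g u = 1 / f u + (1 / g u - overlap U f g u) / real M"

text \<open>Given its place and message, a rival loses when its exponential time exceeds a threshold
  linear in \<open>t\<close>, which gives an exponential probability. Jensen's inequality moves the
  average over place and message into the exponent. Weights of total mass at most one suffice, since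
  only an upper bound on the mean threshold enters.\<close>

lemma emeasure_beats:
  fixes f g :: "'u \<Rightarrow> real"
  assumes "prob_space U" and M: "1 \<le> M"
    and f: "integrable U f" "(\<integral>v. f v \<partial>U) \<le> 1" "\<And>v. 0 \<le> f v"
    and g: "integrable U g" "(\<integral>v. g v \<partial>U) \<le> 1" "\<And>v. 0 \<le> g v"
    and pos: "0 < f u" "0 < g u" "0 \<le> t" and m: "m \<in> {1..M}"
  shows "ennreal (exp (- t * loss_rate U M f g u)) \<le>
    emeasure (code_point_law U M) {z \<in> space (code_point_law U M). beats f g (u, m, t) z}"
proof -
  interpret U: prob_space U by fact
  interpret E: prob_space exp_law by (rule prob_space_exponential_density) simp
  interpret V: prob_space "uniform_count_measure {1..M}"
    by (rule prob_space_uniform_count_measure) (use M in auto)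
  interpret VE: pair_prob_space "uniform_count_measure {1..M}" exp_law ..
  have [measurable]: "f \<in> borel_measurable U" "g \<in> borel_measurable U"
    using f g by auto
  let ?A = "loss_rate U M f g u"
  \<comment> \<open>A rival at \<open>v\<close> with message \<open>l\<close> loses both comparisons
    exactly when its time exceeds \<open>t * c l v\<close>.\<close>
  define c where "c l v = max (f v / f u) (if l = m then g v / g u else 0)" for l v
  have [measurable]: "c l \<in> borel_measurable U" for l unfolding c_def by measurable
  have c0: "0 \<le> c l v" for l v unfolding c_def using f g pos by (simp add: le_max_iff_disj)
  \<comment> \<open>\<open>q v\<close> is the probability of beating a rival at \<open>v\<close>,
    averaged over its uniform message.\<close>
  define q where "q v = (\<Sum>l\<in>{1..M}. exp (- t * c l v)) / real M" for v
  have [measurable]: "q \<in> borel_measurable U" unfolding q_def by measurable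
  let ?W = "{z \<in> space (code_point_law U M). beats f g (u, m, t) z}"
  have W[measurable]: "?W \<in> sets (code_point_law U M)"
    unfolding beats_def by measurable
  have beats_iff: "beats f g (u, m, t) (v, l, r) \<longleftrightarrow> r \<in> {t * c l v<..}" for v l r
  proof -
    have "t * f v < r * f u \<longleftrightarrow> t * (f v / f u) < r"
      using pos by (simp add: pos_divide_less_eq)
    moreover have "t * (if l = m then g v else 0) < r * g u \<longleftrightarrow> t * (if l = m then g v / g u else 0) < r"
      using pos by (simp add: pos_divide_less_eq zero_less_mult_iff)
    ultimately show ?thesis
      using pos unfolding beats_def c_def by (auto simp: max_mult_distrib_left split: if_splits)
  qed
  have "emeasure (code_point_law U M) ?W = (\<integral>\<^sup>+ z. indicator ?W z \<partial>code_point_law U M)"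
    by (rule nn_integral_indicator[symmetric, OF W])
  also have "\<dots> = (\<integral>\<^sup>+ v. \<integral>\<^sup>+ y. indicator ?W (v, y) \<partial>(uniform_count_measure {1..M} \<Otimes>\<^sub>M exp_law) \<partial>U)"
    by (rule VE.nn_integral_fst[symmetric]) measurable
  also have "\<dots> = (\<integral>\<^sup>+ v. \<integral>\<^sup>+ l. \<integral>\<^sup>+ r. indicator ?W (v, l, r) \<partial>exp_law \<partial>uniform_count_measure {1..M} \<partial>U)"
    by (intro nn_integral_cong E.nn_integral_fst[symmetric]) measurable
  also have "\<dots> = (\<integral>\<^sup>+ v. \<integral>\<^sup>+ l. ennreal (exp (- t * c l v)) \<partial>uniform_count_measure {1..M} \<partial>U)"
  proof (intro nn_integral_cong)
    fix v l assume "v \<in> space U" "l \<in> space (uniform_count_measure {1..M})"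
    then have "(\<integral>\<^sup>+ r. indicator ?W (v, l, r) \<partial>exp_law) = (\<integral>\<^sup>+ r. indicator {t * c l v<..} r \<partial>exp_law)"
      by (intro nn_integral_cong) (auto simp: indicator_def space_pair_measure beats_iff)
    also have "\<dots> = ennreal (exp (- t * c l v))"
      using emeasure_exp_law_greaterThan[of "t * c l v"] c0[of l v] pos by simp
    finally show "(\<integral>\<^sup>+ r. indicator ?W (v, l, r) \<partial>exp_law) = ennreal (exp (- t * c l v))" .
  qed
  also have "\<dots> = (\<integral>\<^sup>+ v. ennreal (q v) \<partial>U)"
    using M by (intro nn_integral_cong)
      (simp add: uniform_count_measure_def nn_integral_point_measure_finite q_def sum_divide_distrib
        ennreal_mult'[symmetric] sum_ennreal)
  finally have em: "emeasure (code_point_law U M) ?W = (\<integral>\<^sup>+ v. ennreal (q v) \<partial>U)" .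
  have q: "0 \<le> q v" "q v \<le> 1" for v
  proof -
    show "0 \<le> q v" unfolding q_def by (intro divide_nonneg_nonneg sum_nonneg) auto
    have "(\<Sum>l\<in>{1..M}. exp (- t * c l v)) \<le> (\<Sum>l\<in>{1..M}. 1)"
      using c0 pos by (intro sum_mono) auto
    then show "q v \<le> 1" unfolding q_def using M by (simp add: divide_le_eq)
  qed
  have int_q: "integrable U q"
    by (rule U.integrable_const_bound[of _ 1]) (use q in auto)
  let ?min = "\<lambda>v. min (f v / f u) (g v / g u)"
  have int_min: "integrable U ?min" using f g by (intro integrable_min) auto
  \<comment> \<open>\<open>h v\<close> is the mean of \<open>c l v\<close> over the messages: only
    \<open>l = m\<close> adds something to \<open>f v / f u\<close>.\<close>
  define h where "h v = f v / f u + (g v / g u - ?min v) / real M" for v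
  have int_h: "integrable U h" unfolding h_def using f g int_min by auto
  have h_le: "(\<integral>v. h v \<partial>U) \<le> ?A"
  proof -
    have "(\<integral>v. h v \<partial>U) = (\<integral>v. f v \<partial>U) / f u + ((\<integral>v. g v \<partial>U) / g u - overlap U f g u) / real M"
      unfolding h_def overlap_def using f g int_min by simp
    also have "\<dots> \<le> ?A"
      unfolding loss_rate_def using f g pos by (intro add_mono divide_right_mono diff_mono) auto
    finally show ?thesis .
  qed
  have h_eq: "(\<Sum>l\<in>{1..M}. c l v) / real M = h v" for v
  proof -
    have "c l v = f v / f u + (if l = m then g v / g u - ?min v else 0)" for l
      using f(3)[of v] pos unfolding c_def by (auto simp: max_def min_def divide_le_0_iff)
    then have "(\<Sum>l\<in>{1..M}. c l v) = real M * (f v / f u) + (g v / g u - ?min v)"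
      using m by (simp add: sum.distrib)
    then show ?thesis unfolding h_def using M by (simp add: field_simps)
  qed
  \<comment> \<open>Jensen's inequality for \<open>exp\<close>, via its tangent at the mean\<close>
  have tangent: "exp (- t * ?A) * (1 + t * ?A - t * h v) \<le> q v" for v
  proof -
    have "exp (- t * ?A) * (1 + t * ?A - t * c l v) \<le> exp (- t * c l v)" for l
    proof -
      have "exp (- t * ?A) * (1 + (t * ?A - t * c l v)) \<le> exp (- t * ?A) * exp (t * ?A - t * c l v)"
        by (intro mult_left_mono exp_ge_add_one_self) auto
      then show ?thesis by (simp add: exp_add[symmetric] algebra_simps)
    qed
    then have "(\<Sum>l\<in>{1..M}. exp (- t * ?A) * (1 + t * ?A - t * c l v)) / real M \<le> q v"
      unfolding q_def by (intro divide_right_mono sum_mono) auto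
    also have "(\<Sum>l\<in>{1..M}. exp (- t * ?A) * (1 + t * ?A - t * c l v)) / real M =
        exp (- t * ?A) * (1 + t * ?A - t * ((\<Sum>l\<in>{1..M}. c l v) / real M))"
    proof -
      have "(\<Sum>l\<in>{1..M}. exp (- t * ?A) * (1 + t * ?A - t * c l v)) =
          exp (- t * ?A) * (real M * (1 + t * ?A) - t * (\<Sum>l\<in>{1..M}. c l v))"
        unfolding sum_distrib_left[symmetric] sum_subtractf by simp
      then show ?thesis using M by (simp add: field_simps)
    qed
    finally show ?thesis unfolding h_eq .
  qed
  \<comment> \<open>The mean of \<open>h\<close> is at most the loss rate, so the bracket is at
    least one. Integrating the tangent inequality then gives the bound.\<close>
  have "exp (- t * ?A) \<le> exp (- t * ?A) * (1 + t * ?A - t * (\<integral>v. h v \<partial>U))"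
    using mult_left_mono[OF h_le, of t] pos by (simp add: mult_le_cancel_left1)
  also have "\<dots> = (\<integral>v. exp (- t * ?A) * (1 + t * ?A - t * h v) \<partial>U)"
    using int_h by (simp add: U.prob_space)
  also have "\<dots> \<le> (\<integral>v. q v \<partial>U)"
    using int_h int_q tangent by (intro integral_mono) auto
  finally show ?thesis
    unfolding em using int_q q by (simp add: nn_integral_eq_integral)
qed

lemma measurable_loss_rate [measurable]:
  assumes "prob_space U" 
    and [measurable]: "(\<lambda>(w, u). f w u) \<in> borel_measurable (Q \<Otimes>\<^sub>M U)"
      "(\<lambda>(w, u). g w u) \<in> borel_measurable (Q \<Otimes>\<^sub>M U)"
  shows "(\<lambda>(w, u). loss_rate U M (f w) (g w) u) \<in> borel_measurable (Q \<Otimes>\<^sub>M U)"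
proof -
  interpret prob_space U by fact
  show ?thesis
    unfolding loss_rate_def overlap_def by measurable
qed

text \<open>Dropping the first argument of the minimum bounds the overlap by \<open>1 / g u\<close>.
  The result keeps the rate positive wherever both weights are.\<close>

lemma loss_rate_ge:
  assumes f: "integrable U f" and g: "integrable U g" "(\<integral>v. g v \<partial>U) \<le> 1"
    and pos: "0 < f u" "0 < g u"
  shows "1 / f u \<le> loss_rate U M f g u"
proof -
  have "overlap U f g u \<le> (\<integral>v. g v / g u \<partial>U)"
    unfolding overlap_def using f g by (intro integral_mono integrable_min) auto
  also have "\<dots> \<le> 1 / g u"
    using g pos by (simp add: divide_right_mono)
  finally show ?thesis unfolding loss_rate_def by simp
qed

text \<open>If both weights are positive on a non-null set, the integrand of the overlap is positive
  there for every such \<open>u\<close>, hence so is its integral. Otherwise the premises fail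
  almost everywhere.\<close>

lemma AE_overlap_pos:
  fixes f g :: "'u \<Rightarrow> real"
  assumes f: "integrable U f" "\<And>v. 0 \<le> f v" and g: "integrable U g" "\<And>v. 0 \<le> g v"
  shows "AE u in U. 0 < f u \<longrightarrow> 0 < g u \<longrightarrow> 0 < overlap U f g u"
proof (cases "AE v in U. \<not> (0 < f v \<and> 0 < g v)")
  case True
  then show ?thesis by eventually_elim auto
next
  case False
  have "0 < overlap U f g u" if pos: "0 < f u" "0 < g u" for u
  proof (rule ccontr)
    let ?min = "\<lambda>v. min (f v / f u) (g v / g u)"
    have int: "integrable U ?min" using f g by (intro integrable_min) auto
    have nn: "0 \<le> ?min v" for v using f(2)[of v] g(2)[of v] pos by simp
    assume "\<not> 0 < overlap U f g u"
    moreover have "0 \<le> overlap U f g u"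
      unfolding overlap_def using nn by (intro integral_nonneg_AE) auto
    ultimately have "(\<integral>v. ?min v \<partial>U) = 0" unfolding overlap_def by simp
    then have "AE v in U. ?min v = 0"
      using integral_nonneg_eq_0_iff_AE[OF int] nn by auto
    then have "AE v in U. \<not> (0 < f v \<and> 0 < g v)"
      by eventually_elim (use pos in \<open>auto simp: min_def split: if_splits\<close>)
    with False show False ..
  qed
  then show ?thesis by auto
qed

text \<open>Integrates the bound for \<open>n\<close> independent rivals over the message and the
  time of the code point. The bound does not depend on the message, and the time integral turns the
  exponential into a reciprocal.\<close>

lemma nn_integral_beats:
  fixes f g :: "'u \<Rightarrow> real"
  assumes U: "prob_space U" and M: "1 \<le> M"
    and f: "integrable U f" "(\<integral>v. f v \<partial>U) \<le> 1" "\<And>v. 0 \<le> f v"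
    and g: "integrable U g" "(\<integral>v. g v \<partial>U) \<le> 1" "\<And>v. 0 \<le> g v"
    and B[measurable]: "B \<in> sets U"
  shows "(\<integral>\<^sup>+ u. indicator {u \<in> B. 0 < f u \<and> 0 < g u} u *
        ennreal (1 / (1 + real n * loss_rate U M f g u)) \<partial>U)
    \<le> (\<integral>\<^sup>+ z. indicator B (fst z) * emeasure (code_point_law U M)
          {z' \<in> space (code_point_law U M). beats f g z z'} ^ n \<partial>code_point_law U M)"
proof -
  interpret U: prob_space U by fact
  interpret E: prob_space exp_law by (rule prob_space_exponential_density) simp
  interpret V: prob_space "uniform_count_measure {1..M}"
    by (rule prob_space_uniform_count_measure) (use M in auto)
  interpret VE: pair_prob_space "uniform_count_measure {1..M}" exp_law ..
  have [measurable]: "f \<in> borel_measurable U" "g \<in> borel_measurable U"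
    using f g by auto
  let ?A = "loss_rate U M f g"
  let ?I = "\<lambda>u. indicator {u \<in> B. 0 < f u \<and> 0 < g u} u :: ennreal"
  have [measurable]: "?A \<in> borel_measurable U"
    unfolding loss_rate_def overlap_def by measurable
  have "(\<integral>\<^sup>+ u. ?I u * ennreal (1 / (1 + real n * ?A u)) \<partial>U) =
      (\<integral>\<^sup>+ u. \<integral>\<^sup>+ m. \<integral>\<^sup>+ t. ?I u * (indicator {0..} t * ennreal (exp (- t * (real n * ?A u))))
        \<partial>exp_law \<partial>uniform_count_measure {1..M} \<partial>U)"
  proof (intro nn_integral_cong)
    fix u
    have "(\<integral>\<^sup>+ m. \<integral>\<^sup>+ t. ?I u * (indicator {0..} t * ennreal (exp (- t * (real n * ?A u))))
        \<partial>exp_law \<partial>uniform_count_measure {1..M}) = ?I u * (\<integral>\<^sup>+ t. indicator {0..} t * ennreal (exp (- t * (real n * ?A u))) \<partial>exp_law)"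
      using V.emeasure_space_1 by (simp add: nn_integral_cmult)
    also have "\<dots> = ?I u * ennreal (1 / (1 + real n * ?A u))"
    \<comment> \<open>Positive weights make the rate positive, as the exponential integral requires;
      for all other \<open>u\<close> both sides vanish.\<close>
    proof (cases "0 < f u \<and> 0 < g u")
      case True
      have "0 < 1 / f u" using True by simp
      also have "1 / f u \<le> ?A u" using loss_rate_ge[of U f g u M] f g True by simp
      finally show ?thesis by (subst nn_integral_exp_law_exp) auto
    qed simp
    finally show "?I u * ennreal (1 / (1 + real n * ?A u)) = (\<integral>\<^sup>+ m. \<integral>\<^sup>+ t. ?I u * (indicator {0..} t * ennreal (exp (- t * (real n * ?A u))))
        \<partial>exp_law \<partial>uniform_count_measure {1..M})" ..
  qed
  also have "\<dots> = (\<integral>\<^sup>+ u. \<integral>\<^sup>+ y. ?I u * (indicator {0..} (snd y) * ennreal (exp (- snd y * (real n * ?A u))))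
        \<partial>(uniform_count_measure {1..M} \<Otimes>\<^sub>M exp_law) \<partial>U)"
    by (intro nn_integral_cong, subst E.nn_integral_fst[symmetric]) simp_all
  also have "\<dots> = (\<integral>\<^sup>+ z. ?I (fst z) * (indicator {0..} (snd (snd z)) * ennreal (exp (- snd (snd z) * (real n * ?A (fst z)))))
        \<partial>code_point_law U M)"
    by (subst VE.nn_integral_fst[symmetric]) simp_all
  also have "\<dots> \<le> (\<integral>\<^sup>+ z. indicator B (fst z) * emeasure (code_point_law U M)
          {z' \<in> space (code_point_law U M). beats f g z z'} ^ n \<partial>code_point_law U M)"
  proof (intro nn_integral_mono)
    fix z assume "z \<in> space (code_point_law U M)"
    then obtain u m t where z: "z = (u, m, t)" "m \<in> {1..M}"
      by (cases z) (auto simp: space_pair_measure space_uniform_count_measure)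
    let ?P = "emeasure (code_point_law U M) {z' \<in> space (code_point_law U M). beats f g z z'}"
    show "?I (fst z) * (indicator {0..} (snd (snd z)) * ennreal (exp (- snd (snd z) * (real n * ?A (fst z)))))
      \<le> indicator B (fst z) * ?P ^ n"
    proof (cases "u \<in> B \<and> 0 < f u \<and> 0 < g u \<and> 0 \<le> t")
      case True
      \<comment> \<open>Taking the power for \<open>n\<close> rivals multiplies the rate in the
        exponent by \<open>n\<close>.\<close>
      have "ennreal (exp (- t * (real n * ?A u))) = ennreal (exp (- t * ?A u)) ^ n"
        by (simp add: ennreal_power exp_of_nat_mult[symmetric] algebra_simps)
      also have "\<dots> \<le> ?P ^ n"
        unfolding z(1) using True z(2) by (intro power_mono emeasure_beats U M f g) auto
      finally show ?thesis using True z by simp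
    qed (auto simp: z)
  qed
  finally show ?thesis .
qed

text \<open>Given point \<open>j\<close>, the other \<open>N - 1\<close> points are still
  independent with law \<open>R\<close>, so the conditional probability that \<open>W\<close> holds
  against all of them is a power.\<close>

lemma nn_integral_PiM_beats_all:
  assumes "prob_space R" and j: "j < N"
    and h[measurable]: "h \<in> borel_measurable R"
    and W[measurable]: "(\<lambda>(z, z'). W z z') \<in> R \<Otimes>\<^sub>M R \<rightarrow>\<^sub>M count_space (UNIV :: bool set)"
  shows "(\<integral>\<^sup>+ \<omega>. h (\<omega> j) * of_bool (\<forall>k<N. k \<noteq> j \<longrightarrow> W (\<omega> j) (\<omega> k)) \<partial>Pi\<^sub>M {..<N} (\<lambda>_. R)) =
    (\<integral>\<^sup>+ z. h z * emeasure R {z' \<in> space R. W z z'} ^ (N - 1) \<partial>R)"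
proof -
  interpret R: prob_space R by fact
  interpret product_prob_space "\<lambda>_. R" "{..<N}" ..
  let ?I = "{..<N} - {j}"
  \<comment> \<open>Coordinate \<open>j\<close> is split off the product and becomes the outer
    integration variable; \<open>fun_upd\<close> puts it back.\<close>
  have ins: "{..<N} = insert j ?I" using j by auto
  have [measurable]: "(\<lambda>\<omega>. of_bool (\<forall>k<N. k \<noteq> j \<longrightarrow> W (\<omega> j) (\<omega> k)) :: ennreal) \<in> borel_measurable (Pi\<^sub>M {..<N} (\<lambda>_. R))"
  proof -
    have [measurable]: "Measurable.pred (Pi\<^sub>M {..<N} (\<lambda>_. R)) (\<lambda>\<omega>. W (\<omega> j) (\<omega> k))" if "k < N" for k
    proof -
      have [measurable]: "j \<in> {..<N}" "k \<in> {..<N}" using j that by auto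
      show ?thesis by measurable
    qed
    have "Measurable.pred (Pi\<^sub>M {..<N} (\<lambda>_. R)) (\<lambda>\<omega>. \<forall>k\<in>{..<N}. k \<noteq> j \<longrightarrow> W (\<omega> j) (\<omega> k))"
      by measurable
    then have [measurable]: "Measurable.pred (Pi\<^sub>M {..<N} (\<lambda>_. R)) (\<lambda>\<omega>. \<forall>k<N. k \<noteq> j \<longrightarrow> W (\<omega> j) (\<omega> k))"
      by (simp add: Ball_def)
    show ?thesis by measurable
  qed
  have [measurable]: "(\<lambda>\<omega>. h (\<omega> j)) \<in> borel_measurable (Pi\<^sub>M {..<N} (\<lambda>_. R))"
    using j by (intro measurable_compose[OF measurable_component_singleton[of j "{..<N}" "\<lambda>_. R"] h]) auto
  have "(\<integral>\<^sup>+ \<omega>. h (\<omega> j) * of_bool (\<forall>k<N. k \<noteq> j \<longrightarrow> W (\<omega> j) (\<omega> k)) \<partial>Pi\<^sub>M {..<N} (\<lambda>_. R)) =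
      (\<integral>\<^sup>+ z. \<integral>\<^sup>+ \<omega>. h ((fun_upd \<omega> j z) j) * of_bool (\<forall>k<N. k \<noteq> j \<longrightarrow> W ((fun_upd \<omega> j z) j) ((fun_upd \<omega> j z) k))
        \<partial>Pi\<^sub>M ?I (\<lambda>_. R) \<partial>R)"
    by (subst ins, rule product_nn_integral_insert_rev) (simp_all add: ins[symmetric])
  also have "\<dots> = (\<integral>\<^sup>+ z. h z * emeasure R {z' \<in> space R. W z z'} ^ (N - 1) \<partial>R)"
  proof (intro nn_integral_cong)
    fix z assume [measurable]: "z \<in> space R"
    let ?B = "\<lambda>k :: nat. {z' \<in> space R. W z z'}"
    have [measurable]: "{z' \<in> space R. W z z'} \<in> sets R" by measurable
    have box: "Pi\<^sub>E ?I ?B \<in> sets (Pi\<^sub>M ?I (\<lambda>_. R))" by (intro sets_PiM_I_finite) auto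
    have "(\<integral>\<^sup>+ \<omega>. h ((fun_upd \<omega> j z) j) * of_bool (\<forall>k<N. k \<noteq> j \<longrightarrow> W ((fun_upd \<omega> j z) j) ((fun_upd \<omega> j z) k))
        \<partial>Pi\<^sub>M ?I (\<lambda>_. R)) = (\<integral>\<^sup>+ \<omega>. h z * indicator (Pi\<^sub>E ?I ?B) \<omega> \<partial>Pi\<^sub>M ?I (\<lambda>_. R))"
      by (intro nn_integral_cong) (auto simp: indicator_def space_PiM PiE_iff extensional_def)
    also have "\<dots> = h z * emeasure (Pi\<^sub>M ?I (\<lambda>_. R)) (Pi\<^sub>E ?I ?B)"
      using box by (rule nn_integral_cmult_indicator)
    also have "emeasure (Pi\<^sub>M ?I (\<lambda>_. R)) (Pi\<^sub>E ?I ?B) = (\<Prod>k\<in>?I. emeasure R (?B k))"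
      by (rule emeasure_PiM) auto
    finally show "(\<integral>\<^sup>+ \<omega>. h ((fun_upd \<omega> j z) j) * of_bool (\<forall>k<N. k \<noteq> j \<longrightarrow> W ((fun_upd \<omega> j z) j) ((fun_upd \<omega> j z) k))
        \<partial>Pi\<^sub>M ?I (\<lambda>_. R)) = h z * emeasure R {z' \<in> space R. W z z'} ^ (N - 1)"
      using j by simp
  qed
  finally show ?thesis .
qed

section \<open>Random codebooks\<close>

definition race_encoder ::
    "nat \<Rightarrow> ('x \<times> 'u \<Rightarrow> real) \<Rightarrow> (nat \<Rightarrow> 'u \<times> nat \<times> real) \<Rightarrow> 'x \<Rightarrow> nat" where
  "race_encoder N f \<omega> x =
     fst (snd (\<omega> (race N (\<lambda>k. f (x, fst (\<omega> k))) (\<lambda>k. snd (snd (\<omega> k))))))"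

text \<open>Weight zero stands for an infinite score, so that the race is run among the code points
  carrying the received message \<open>fst p\<close>.\<close>

definition race_decoder ::
    "nat \<Rightarrow> ('y \<times> 'u \<Rightarrow> real) \<Rightarrow> (nat \<Rightarrow> 'u \<times> nat \<times> real) \<Rightarrow> nat \<times> 'y \<Rightarrow> 'u" where
  "race_decoder N g \<omega> p =
     fst (\<omega> (race N (\<lambda>k. if fst (snd (\<omega> k)) = fst p then g (snd p, fst (\<omega> k)) else 0)
       (\<lambda>k. snd (snd (\<omega> k)))))"

text \<open>A point that beats all others wins the encoder's race. The received message is then its
  own, which is the case for which \<open>beats\<close> states the decoder's comparison, so it wins
  the second race too.\<close>

lemma race_decoder_encoder:
  assumes "j < N"
    and "\<And>k. k < N \<Longrightarrow> k \<noteq> j \<Longrightarrow> beats (\<lambda>u. f (x, u)) (\<lambda>u. g (y, u)) (\<omega> j) (\<omega> k)"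
  shows "race_decoder N g \<omega> (race_encoder N f \<omega> x, y) = fst (\<omega> j)"
proof -
  have "race N (\<lambda>k. f (x, fst (\<omega> k))) (\<lambda>k. snd (snd (\<omega> k))) = j"
    using assms by (intro race_eq) (auto simp: beats_def)
  then have enc: "race_encoder N f \<omega> x = fst (snd (\<omega> j))"
    by (simp add: race_encoder_def)
  have dec: "race N (\<lambda>k. if fst (snd (\<omega> k)) = fst (snd (\<omega> j)) then g (y, fst (\<omega> k)) else 0)
      (\<lambda>k. snd (snd (\<omega> k))) = j"
    using assms by (intro race_eq) (auto simp: beats_def)
  show ?thesis unfolding race_decoder_def enc fst_conv snd_conv dec ..
qed

section \<open>Measurability of the races and of the winning event\<close>

lemma measurable_race:
  assumes [measurable]: "\<And>k. k < N \<Longrightarrow> w k \<in> borel_measurable X" and N: "0 < N"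
  shows "(\<lambda>x. race N (\<lambda>k. w k x) T) \<in> X \<rightarrow>\<^sub>M count_space {..<N}"
proof -
  have "(\<lambda>x. race N (\<lambda>k. w k x) T) \<in> X \<rightarrow>\<^sub>M count_space UNIV"
    unfolding race_def
  proof (rule measurable_Least)
    fix j
    show "(\<lambda>x. N \<le> Suc j \<or> (\<forall>k<N. k \<noteq> j \<longrightarrow> T j * w k x < T k * w j x)) \<in> X \<rightarrow>\<^sub>M count_space UNIV"
    \<comment> \<open>Measurability of \<open>w j\<close> is only given for \<open>j < N\<close>;
      when \<open>N \<le> Suc j\<close> the predicate is constantly true.\<close>
    proof (cases "N \<le> Suc j")
      case False
      then have [measurable]: "w j \<in> borel_measurable X" by simp
      have "Measurable.pred X (\<lambda>x. \<forall>k\<in>{..<N}. k \<noteq> j \<longrightarrow> T j * w k x < T k * w j x)"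
        by measurable
      then show ?thesis using False by (simp add: Ball_def)
    qed simp
  qed
  then show ?thesis
    using race_less[OF N] by (auto simp: measurable_count_space_eq2 measurable_count_space_eq2_countable Pi_iff)
qed

lemma space_code_point_law:
  "z \<in> space (code_point_law U M) \<longleftrightarrow> fst z \<in> space U \<and> fst (snd z) \<in> {1..M}"
  by (cases z) (auto simp: space_pair_measure space_uniform_count_measure)

lemma measurable_race_encoder:
  assumes [measurable]: "f \<in> borel_measurable (X \<Otimes>\<^sub>M U)" and N: "0 < N"
    and \<omega>: "\<And>k. k < N \<Longrightarrow> \<omega> k \<in> space (code_point_law U M)"
  shows "race_encoder N f \<omega> \<in> X \<rightarrow>\<^sub>M count_space {1..M}"
proof -
  have "(\<lambda>x. race N (\<lambda>k. f (x, fst (\<omega> k))) (\<lambda>k. snd (snd (\<omega> k)))) \<in> X \<rightarrow>\<^sub>M count_space {..<N}"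
  proof (rule measurable_race[OF _ N])
    fix k assume "k < N"
    then have [measurable]: "fst (\<omega> k) \<in> space U"
      using \<omega> unfolding space_code_point_law by blast
    show "(\<lambda>x. f (x, fst (\<omega> k))) \<in> borel_measurable X" by measurable
  qed
  from measurable_compose[OF this, of "\<lambda>i. fst (snd (\<omega> i))" "count_space {1..M}"]
  show ?thesis
    using \<omega> unfolding race_encoder_def space_code_point_law by (simp add: Pi_iff)
qed

lemma measurable_race_decoder:
  assumes [measurable]: "g \<in> borel_measurable (Y \<Otimes>\<^sub>M U)" and N: "0 < N"
    and \<omega>: "\<And>k. k < N \<Longrightarrow> \<omega> k \<in> space (code_point_law U M)"
  shows "race_decoder N g \<omega> \<in> count_space {1..M} \<Otimes>\<^sub>M Y \<rightarrow>\<^sub>M U"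
proof -
  have "(\<lambda>p. race N (\<lambda>k. if fst (snd (\<omega> k)) = fst p then g (snd p, fst (\<omega> k)) else 0)
      (\<lambda>k. snd (snd (\<omega> k)))) \<in> count_space {1..M} \<Otimes>\<^sub>M Y \<rightarrow>\<^sub>M count_space {..<N}"
  proof (rule measurable_race[OF _ N])
    fix k assume "k < N"
    then have [measurable]: "fst (\<omega> k) \<in> space U"
      using \<omega> unfolding space_code_point_law by blast
    show "(\<lambda>p. if fst (snd (\<omega> k)) = fst p then g (snd p, fst (\<omega> k)) else 0)
      \<in> borel_measurable (count_space {1..M} \<Otimes>\<^sub>M Y)" by measurable
  qed
  from measurable_compose[OF this, of "\<lambda>i. fst (\<omega> i)" U]
  show ?thesis
    using \<omega> unfolding race_decoder_def space_code_point_law by (simp add: Pi_iff)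
qed

text \<open>Joint measurability in the source outcome and both code points is what allows source and
  codebook to be integrated in either order.\<close>

lemma measurable_beats:
  assumes f: "(\<lambda>(w, u). f w u) \<in> borel_measurable (Q \<Otimes>\<^sub>M U)"
    and g: "(\<lambda>(w, u). g w u) \<in> borel_measurable (Q \<Otimes>\<^sub>M U)"
    and b: "b \<in> N \<rightarrow>\<^sub>M Q"
    and z: "z \<in> N \<rightarrow>\<^sub>M code_point_law U M" and z': "z' \<in> N \<rightarrow>\<^sub>M code_point_law U M"
  shows "Measurable.pred N (\<lambda>p. beats (f (b p)) (g (b p)) (z p) (z' p))"
proof -
  have proj: "fst \<in> code_point_law U M \<rightarrow>\<^sub>M U" "(\<lambda>p. snd (snd p)) \<in> borel_measurable (code_point_law U M)"
    by measurable
  have "(\<lambda>p. fst (snd p)) \<in> code_point_law U M \<rightarrow>\<^sub>M uniform_count_measure {1..M}"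
    by measurable
  moreover have "(\<lambda>l. l) \<in> uniform_count_measure {1..M} \<rightarrow>\<^sub>M count_space UNIV"
    by (auto simp: measurable_def sets_uniform_count_measure space_uniform_count_measure)
  ultimately have msg: "(\<lambda>p. fst (snd p)) \<in> code_point_law U M \<rightarrow>\<^sub>M count_space UNIV"
    by (rule measurable_compose)
  have weight: "(\<lambda>p. h (b p) (fst (y p))) \<in> borel_measurable N"
    if "(\<lambda>(w, u). h w u) \<in> borel_measurable (Q \<Otimes>\<^sub>M U)" "y \<in> N \<rightarrow>\<^sub>M code_point_law U M"
    for h :: "'a \<Rightarrow> 'b \<Rightarrow> real" and y
    using measurable_compose[OF measurable_Pair[OF b measurable_compose[OF that(2) proj(1)]] that(1)]
    by simp
  have pred: "Measurable.pred N (\<lambda>p. t p * fv p < r p * fu p \<and> t p * (if l p = m p then gv p else 0) < r p * gu p)"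
    if m: "t \<in> borel_measurable N" "r \<in> borel_measurable N"
      "fu \<in> borel_measurable N" "fv \<in> borel_measurable N"
      "gu \<in> borel_measurable N" "gv \<in> borel_measurable N"
      "l \<in> N \<rightarrow>\<^sub>M count_space UNIV" "m \<in> N \<rightarrow>\<^sub>M count_space UNIV"
    for t r fu fv gu gv :: "'c \<Rightarrow> real" and l m :: "'c \<Rightarrow> nat"
  proof -
    \<comment> \<open>Messages are compared as real numbers, so that the set where two measurable
      functions agree is measurable by the Borel rule.\<close>
    have "(\<lambda>p. real (l p)) \<in> borel_measurable N" "(\<lambda>p. real (m p)) \<in> borel_measurable N"
      by (auto intro: measurable_compose[OF m(7)] measurable_compose[OF m(8)])
    then have "{p \<in> space N. real (l p) = real (m p)} \<in> sets N"
      by (rule borel_measurable_eq)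
    then have "Measurable.pred N (\<lambda>p. t p * fv p < r p * fu p \<and>
        t p * (if real (l p) = real (m p) then gv p else 0) < r p * gu p)"
      by (intro pred_intros_logic borel_measurable_pred_less borel_measurable_times measurable_If
        borel_measurable_const m(1-6))
    then show ?thesis by simp
  qed
  show ?thesis
    unfolding beats_def
    by (rule pred[OF measurable_compose[OF z proj(2)] measurable_compose[OF z' proj(2)]
      weight[OF f z] weight[OF f z'] weight[OF g z] weight[OF g z']
      measurable_compose[OF z' msg] measurable_compose[OF z msg]])
qed

lemma measurable_of_bool_all:
  fixes N :: nat
  assumes "\<And>k. k < N \<Longrightarrow> Measurable.pred L (V k)"
  shows "(\<lambda>p. of_bool (\<forall>k<N. k \<noteq> j \<longrightarrow> V k p) :: ennreal) \<in> borel_measurable L"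
proof -
  have "Measurable.pred L (\<lambda>p. \<forall>k\<in>{..<N} - {j}. V k p)"
    by (rule pred_intros_finite) (use assms in auto)
  then have "(\<lambda>p. of_bool (\<forall>k\<in>{..<N} - {j}. V k p) :: ennreal) \<in> borel_measurable L"
    by (rule measurable_compose) simp
  moreover have "(\<forall>k\<in>{..<N} - {j}. V k p) \<longleftrightarrow> (\<forall>k<N. k \<noteq> j \<longrightarrow> V k p)" for p
    by blast
  ultimately show ?thesis by (simp only:)
qed

section \<open>Success probability of a random codebook\<close>

text \<open>The outcome \<open>w\<close> is the whole source: the encoder sees
  \<open>\<xi> w\<close>, the decoder \<open>\<eta> w\<close>, and \<open>G\<close> holds the pairs
  for which decoding to \<open>u\<close> is acceptable. The weights are only normalized up to null
  sets and from above, which fits real-valued versions of extended densities.\<close>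

locale matching_problem = Q: prob_space Q + U: prob_space U
  for Q :: "'w measure" and U :: "'u measure" +
  fixes X :: "'x measure" and Y :: "'y measure" and \<xi> :: "'w \<Rightarrow> 'x" and \<eta> :: "'w \<Rightarrow> 'y"
    and f :: "'x \<times> 'u \<Rightarrow> real" and g :: "'y \<times> 'u \<Rightarrow> real" and M :: nat and G :: "('w \<times> 'u) set"
  assumes measurable_src [measurable]: "\<xi> \<in> Q \<rightarrow>\<^sub>M X" "\<eta> \<in> Q \<rightarrow>\<^sub>M Y"
    and measurable_weights [measurable]:
      "f \<in> borel_measurable (X \<Otimes>\<^sub>M U)" "g \<in> borel_measurable (Y \<Otimes>\<^sub>M U)"
    and f_nonneg: "\<And>p. 0 \<le> f p" and g_nonneg: "\<And>p. 0 \<le> g p"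
    and f_subprob: "AE w in Q. integrable U (\<lambda>u. f (\<xi> w, u)) \<and> (\<integral>u. f (\<xi> w, u) \<partial>U) \<le> 1"
    and g_subprob: "AE w in Q. integrable U (\<lambda>u. g (\<eta> w, u)) \<and> (\<integral>u. g (\<eta> w, u) \<partial>U) \<le> 1"
    and M_pos: "1 \<le> M"
    and sets_G [measurable]: "G \<in> sets (Q \<Otimes>\<^sub>M U)"
begin

sublocale QU: pair_prob_space Q U ..

definition good :: "('w \<times> 'u) set" where
  "good = {p \<in> G. 0 < f (\<xi> (fst p), snd p) \<and> 0 < g (\<eta> (fst p), snd p)}"

definition rate :: "'w \<times> 'u \<Rightarrow> real" where
  "rate p = loss_rate U M (\<lambda>u. f (\<xi> (fst p), u)) (\<lambda>u. g (\<eta> (fst p), u)) (snd p)"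

text \<open>The rate without the gain from the overlap. Its reciprocal is the integrand of the
  claimed bound, once that is written under the product measure.\<close>

definition full_rate :: "'w \<times> 'u \<Rightarrow> real" where
  "full_rate p = 1 / f (\<xi> (fst p), snd p) + 1 / g (\<eta> (fst p), snd p) / real M"

definition success :: "nat \<Rightarrow> (nat \<Rightarrow> 'u \<times> nat \<times> real) \<Rightarrow> ennreal" where
  "success N \<omega> = emeasure Q {w \<in> space Q. (w, race_decoder N g \<omega> (race_encoder N f \<omega> (\<xi> w), \<eta> w)) \<in> G}"

lemma measurable_good [measurable]: "good \<in> sets (Q \<Otimes>\<^sub>M U)"
proof -
  have "good = G \<inter> {p \<in> space (Q \<Otimes>\<^sub>M U). 0 < f (\<xi> (fst p), snd p) \<and> 0 < g (\<eta> (fst p), snd p)}"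
    using sets.sets_into_space[OF sets_G] by (auto simp: good_def)
  also have "\<dots> \<in> sets (Q \<Otimes>\<^sub>M U)" by measurable
  finally show ?thesis .
qed

lemma measurable_rate [measurable]: "rate \<in> borel_measurable (Q \<Otimes>\<^sub>M U)"
proof -
  have "(\<lambda>(w, u). loss_rate U M ((\<lambda>w u. f (\<xi> w, u)) w) ((\<lambda>w u. g (\<eta> w, u)) w) u) \<in> borel_measurable (Q \<Otimes>\<^sub>M U)"
    by (rule measurable_loss_rate[OF U.prob_space_axioms]) measurable
  then show ?thesis by (simp add: rate_def[abs_def] split_beta')
qed

lemma measurable_full_rate [measurable]: "full_rate \<in> borel_measurable (Q \<Otimes>\<^sub>M U)"
  unfolding full_rate_def by measurable

lemma prob_space_codebook: "prob_space (code_point_law U M)"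
proof -
  interpret E: prob_space exp_law by (rule prob_space_exponential_density) simp
  interpret V: prob_space "uniform_count_measure {1..M}"
    by (rule prob_space_uniform_count_measure) (use M_pos in auto)
  interpret VE: pair_prob_space "uniform_count_measure {1..M}" exp_law ..
  interpret UVE: pair_prob_space U "uniform_count_measure {1..M} \<Otimes>\<^sub>M exp_law" ..
  show ?thesis by (rule UVE.prob_space_axioms)
qed

text \<open>The events that a given index beats all \<open>n\<close> others are disjoint, and on
  each of them the decoder outputs the winner's \<open>u\<close>. All \<open>Suc n\<close> indices
  satisfy the same lower bound, hence the factor \<open>Suc n\<close>.\<close>

lemma mean_success_ge:
  "(\<integral>\<^sup>+ p. indicator good p * ennreal (real (Suc n) / (1 + real n * rate p)) \<partial>(Q \<Otimes>\<^sub>M U))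
    \<le> (\<integral>\<^sup>+ \<omega>. success (Suc n) \<omega> \<partial>Pi\<^sub>M {..<Suc n} (\<lambda>_. code_point_law U M))"
proof -
  let ?R = "code_point_law U M" and ?N = "Suc n"
  let ?C = "Pi\<^sub>M {..<?N} (\<lambda>_. ?R)"
  interpret R: prob_space ?R by (rule prob_space_codebook)
  interpret C: product_prob_space "\<lambda>_. ?R" "{..<?N}" ..
  interpret C: prob_space ?C by (rule prob_space_PiM) (rule R.prob_space_axioms)
  interpret CQ: pair_prob_space ?C Q ..
  let ?W = "\<lambda>w. beats (\<lambda>u. f (\<xi> w, u)) (\<lambda>u. g (\<eta> w, u))"
  \<comment> \<open>The indicator that point \<open>j\<close> beats all others and that its place is
    acceptable for \<open>w\<close>.\<close>
  let ?win = "\<lambda>\<omega> w j. indicator G (w, fst (\<omega> j)) * of_bool (\<forall>k<?N. k \<noteq> j \<longrightarrow> ?W w (\<omega> j) (\<omega> k)) :: ennreal"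
  have win_measurable: "(\<lambda>(\<omega>, w). ?win \<omega> w j) \<in> borel_measurable (?C \<Otimes>\<^sub>M Q)" if j: "j < ?N" for j
  proof -
    have comp: "(\<lambda>p. fst p k) \<in> ?C \<Otimes>\<^sub>M Q \<rightarrow>\<^sub>M ?R" if "k < ?N" for k
      using that by (intro measurable_compose[OF measurable_fst measurable_component_singleton]) auto
    have W: "Measurable.pred (?C \<Otimes>\<^sub>M Q) (\<lambda>p. ?W (snd p) (fst p j) (fst p k))" if "k < ?N" for k
      by (rule measurable_beats[of "\<lambda>w u. f (\<xi> w, u)" Q U "\<lambda>w u. g (\<eta> w, u)" snd "?C \<Otimes>\<^sub>M Q"
            "\<lambda>p. fst p j" M "\<lambda>p. fst p k", OF _ _ measurable_snd comp[OF j] comp[OF that]])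
        measurable
    have "(\<lambda>p. (snd p, fst (fst p j))) \<in> ?C \<Otimes>\<^sub>M Q \<rightarrow>\<^sub>M Q \<Otimes>\<^sub>M U"
      by (intro measurable_Pair measurable_snd measurable_compose[OF comp[OF j] measurable_fst])
    then have "(\<lambda>p. indicator G (snd p, fst (fst p j))) \<in> borel_measurable (?C \<Otimes>\<^sub>M Q)"
      by (rule measurable_compose) measurable
    moreover have "(\<lambda>p. of_bool (\<forall>k<?N. k \<noteq> j \<longrightarrow> ?W (snd p) (fst p j) (fst p k)) :: ennreal)
        \<in> borel_measurable (?C \<Otimes>\<^sub>M Q)"
      by (rule measurable_of_bool_all) (rule W)
    ultimately show ?thesis
      unfolding split_beta' by (rule borel_measurable_times_ennreal)
  qed
  have "(\<integral>\<^sup>+ p. indicator good p * ennreal (real ?N / (1 + real n * rate p)) \<partial>(Q \<Otimes>\<^sub>M U)) =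
      (\<integral>\<^sup>+ w. \<integral>\<^sup>+ u. indicator good (w, u) * ennreal (real ?N / (1 + real n * rate (w, u))) \<partial>U \<partial>Q)"
    by (rule U.nn_integral_fst[symmetric]) measurable
  also have "\<dots> \<le> (\<integral>\<^sup>+ w. (\<Sum>j<?N. \<integral>\<^sup>+ \<omega>. ?win \<omega> w j \<partial>?C) \<partial>Q)"
  proof (rule nn_integral_mono_AE)
    show "AE w in Q. (\<integral>\<^sup>+ u. indicator good (w, u) * ennreal (real ?N / (1 + real n * rate (w, u))) \<partial>U)
        \<le> (\<Sum>j<?N. \<integral>\<^sup>+ \<omega>. ?win \<omega> w j \<partial>?C)"
      using f_subprob g_subprob AE_space
    proof eventually_elim
      fix w assume f: "integrable U (\<lambda>u. f (\<xi> w, u)) \<and> (\<integral>u. f (\<xi> w, u) \<partial>U) \<le> 1"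
        and g: "integrable U (\<lambda>u. g (\<eta> w, u)) \<and> (\<integral>u. g (\<eta> w, u) \<partial>U) \<le> 1"
        and w [measurable]: "w \<in> space Q"
      \<comment> \<open>For fixed \<open>w\<close> only the section of \<open>G\<close> at
        \<open>w\<close> matters, which reduces the estimate to
        \<open>nn_integral_beats\<close>.\<close>
      let ?B = "Pair w -` G"
      have B[measurable]: "?B \<in> sets U" by (rule sets_Pair1[OF sets_G])
      have W [measurable]: "(\<lambda>(z, z'). ?W w z z') \<in> ?R \<Otimes>\<^sub>M ?R \<rightarrow>\<^sub>M count_space UNIV"
        unfolding split_beta'
        by (rule measurable_beats[of "\<lambda>w u. f (\<xi> w, u)" Q U "\<lambda>w u. g (\<eta> w, u)" "\<lambda>_. w" "?R \<Otimes>\<^sub>M ?R" fst M snd])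
          measurable
      have "(\<integral>\<^sup>+ u. indicator good (w, u) * ennreal (1 / (1 + real n * rate (w, u))) \<partial>U) \<le>
         (\<integral>\<^sup>+ z. indicator ?B (fst z) * emeasure ?R {z' \<in> space ?R. ?W w z z'} ^ n \<partial>?R)"
        using nn_integral_beats[OF U.prob_space_axioms M_pos conjunct1[OF f] conjunct2[OF f] f_nonneg
            conjunct1[OF g] conjunct2[OF g] g_nonneg B, of n]
        by (simp add: good_def rate_def indicator_def)
      also have "\<dots> = (\<integral>\<^sup>+ \<omega>. ?win \<omega> w j \<partial>?C)" if "j < ?N" for j
        using nn_integral_PiM_beats_all[OF R.prob_space_axioms that, of "\<lambda>z. indicator ?B (fst z)" "?W w"] W
        by (simp add: indicator_def)
      finally have le: "(\<integral>\<^sup>+ u. indicator good (w, u) * ennreal (1 / (1 + real n * rate (w, u))) \<partial>U) \<le>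
         (\<integral>\<^sup>+ \<omega>. ?win \<omega> w j \<partial>?C)" if "j < ?N" for j using that by simp
      have "(\<integral>\<^sup>+ u. indicator good (w, u) * ennreal (real ?N / (1 + real n * rate (w, u))) \<partial>U) =
        (\<integral>\<^sup>+ u. of_nat ?N * (indicator good (w, u) * ennreal (1 / (1 + real n * rate (w, u)))) \<partial>U)"
        by (intro nn_integral_cong)
          (simp add: ennreal_of_nat_eq_real_of_nat ennreal_mult'[symmetric] indicator_def del: of_nat_Suc)
      \<comment> \<open>The factor \<open>?N\<close> is spread over the possible winners, so that
        each summand can be bounded by the event of its own index.\<close>
      also have "\<dots> = (\<Sum>j<?N. \<integral>\<^sup>+ u. indicator good (w, u) * ennreal (1 / (1 + real n * rate (w, u))) \<partial>U)"
        by (subst nn_integral_cmult) simp_all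
      also have "\<dots> \<le> (\<Sum>j<?N. \<integral>\<^sup>+ \<omega>. ?win \<omega> w j \<partial>?C)"
        by (intro sum_mono le) simp
      finally show "(\<integral>\<^sup>+ u. indicator good (w, u) * ennreal (real ?N / (1 + real n * rate (w, u))) \<partial>U)
        \<le> (\<Sum>j<?N. \<integral>\<^sup>+ \<omega>. ?win \<omega> w j \<partial>?C)" .
    qed
  qed
  also have "\<dots> = (\<integral>\<^sup>+ w. \<integral>\<^sup>+ \<omega>. (\<Sum>j<?N. ?win \<omega> w j) \<partial>?C \<partial>Q)"
  proof (rule nn_integral_cong)
    fix w assume w: "w \<in> space Q"
    have "(\<lambda>\<omega>. ?win \<omega> w j) \<in> borel_measurable ?C" if "j < ?N" for j
      using measurable_compose[OF measurable_Pair2'[OF w] win_measurable[OF that]]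
      unfolding prod.case .
    then show "(\<Sum>j<?N. \<integral>\<^sup>+ \<omega>. ?win \<omega> w j \<partial>?C) = (\<integral>\<^sup>+ \<omega>. (\<Sum>j<?N. ?win \<omega> w j) \<partial>?C)"
      by (subst nn_integral_sum) simp_all
  qed
  also have "\<dots> = (\<integral>\<^sup>+ \<omega>. \<integral>\<^sup>+ w. (\<Sum>j<?N. ?win \<omega> w j) \<partial>Q \<partial>?C)"
  \<comment> \<open>The exchange turns a bound for each source outcome into one for each
    codebook.\<close>
  proof (rule CQ.Fubini')
    show "(\<lambda>(\<omega>, w). \<Sum>j<?N. ?win \<omega> w j) \<in> borel_measurable (?C \<Otimes>\<^sub>M Q)"
      unfolding split_beta'
      by (intro borel_measurable_sum win_measurable[unfolded split_beta']) simp
  qed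
  also have "\<dots> \<le> (\<integral>\<^sup>+ \<omega>. success ?N \<omega> \<partial>?C)"
  proof (intro nn_integral_mono)
    fix \<omega> assume "\<omega> \<in> space ?C"
    then have \<omega>: "\<omega> k \<in> space ?R" if "k < ?N" for k using that by (auto simp: space_PiM)
    note [measurable] = measurable_race_encoder[OF measurable_weights(1) zero_less_Suc \<omega>]
      measurable_race_decoder[OF measurable_weights(2) zero_less_Suc \<omega>]
    let ?S = "{w \<in> space Q. (w, race_decoder ?N g \<omega> (race_encoder ?N f \<omega> (\<xi> w), \<eta> w)) \<in> G}"
    have [measurable]: "?S \<in> sets Q" by measurable
    have "(\<Sum>j<?N. ?win \<omega> w j) \<le> indicator ?S w" if w: "w \<in> space Q" for w
    proof (cases "\<exists>j<?N. \<forall>k<?N. k \<noteq> j \<longrightarrow> ?W w (\<omega> j) (\<omega> k)")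
      case True
      then obtain j where j: "j < ?N" "\<And>k. k < ?N \<Longrightarrow> k \<noteq> j \<Longrightarrow> ?W w (\<omega> j) (\<omega> k)" by blast
      \<comment> \<open>Two winners would have to beat each other, which the strict comparison of
        scores excludes. At most one summand survives.\<close>
      have "\<not> (\<forall>k<?N. k \<noteq> i \<longrightarrow> ?W w (\<omega> i) (\<omega> k))" if "i < ?N" "i \<noteq> j" for i
        using j(2)[OF that] that j(1) by (force simp: beats_def)
      then have "(\<Sum>i<?N. ?win \<omega> w i) = (\<Sum>i<?N. if i = j then ?win \<omega> w j else 0)"
        by (intro sum.cong) auto
      also have "\<dots> = ?win \<omega> w j" using j(1) by simp
      also have "\<dots> \<le> indicator ?S w"
        using race_decoder_encoder[of j ?N f "\<xi> w" g "\<eta> w" \<omega>] j w by (auto simp: indicator_def)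
      finally show ?thesis .
    next
      case False
      then have "(\<Sum>i<?N. ?win \<omega> w i) = (\<Sum>i<?N. 0)"
        by (intro sum.cong) auto
      then show ?thesis by (simp only: sum.neutral_const zero_le)
    qed
    then have "(\<integral>\<^sup>+ w. (\<Sum>j<?N. ?win \<omega> w j) \<partial>Q) \<le> (\<integral>\<^sup>+ w. indicator ?S w \<partial>Q)"
      by (rule nn_integral_mono)
    then show "(\<integral>\<^sup>+ w. (\<Sum>j<?N. ?win \<omega> w j) \<partial>Q) \<le> success ?N \<omega>"
      unfolding success_def by simp
  qed
  finally show ?thesis .
qed

text \<open>Positivity comes from \<open>loss_rate_ge\<close> and strictness from the positive
  overlap. The strict gap is what allows a finite codebook to reach the bound without any
  loss.\<close>

lemma AE_rate_bounds:
  "AE p in Q \<Otimes>\<^sub>M U. p \<in> good \<longrightarrow> 0 < rate p \<and> rate p < full_rate p"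
proof -
  have [measurable]: "Measurable.pred (Q \<Otimes>\<^sub>M U) (\<lambda>p. p \<in> good \<longrightarrow> 0 < rate p \<and> rate p < full_rate p)"
    by measurable
  have "AE w in Q. AE u in U. (w, u) \<in> good \<longrightarrow> 0 < rate (w, u) \<and> rate (w, u) < full_rate (w, u)"
    using f_subprob g_subprob
  proof eventually_elim
    fix w assume f: "integrable U (\<lambda>u. f (\<xi> w, u)) \<and> (\<integral>u. f (\<xi> w, u) \<partial>U) \<le> 1"
      and g: "integrable U (\<lambda>u. g (\<eta> w, u)) \<and> (\<integral>u. g (\<eta> w, u) \<partial>U) \<le> 1"
    from AE_overlap_pos[OF conjunct1[OF f] f_nonneg conjunct1[OF g] g_nonneg]
    show "AE u in U. (w, u) \<in> good \<longrightarrow> 0 < rate (w, u) \<and> rate (w, u) < full_rate (w, u)"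
    proof eventually_elim
      fix u assume ov: "0 < f (\<xi> w, u) \<longrightarrow> 0 < g (\<eta> w, u) \<longrightarrow>
        0 < overlap U (\<lambda>u. f (\<xi> w, u)) (\<lambda>u. g (\<eta> w, u)) u"
      show "(w, u) \<in> good \<longrightarrow> 0 < rate (w, u) \<and> rate (w, u) < full_rate (w, u)"
      proof
        assume "(w, u) \<in> good"
        then have pos: "0 < f (\<xi> w, u)" "0 < g (\<eta> w, u)" by (auto simp: good_def)
        have "0 < 1 / f (\<xi> w, u)" using pos by simp
        also have "\<dots> \<le> rate (w, u)"
          using loss_rate_ge[OF conjunct1[OF f] conjunct1[OF g] conjunct2[OF g], of u M] pos
          by (simp add: rate_def)
        finally have "0 < rate (w, u)" .
        moreover have "rate (w, u) < full_rate (w, u)"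
          using ov pos M_pos by (simp add: rate_def full_rate_def loss_rate_def diff_divide_distrib)
        ultimately show "0 < rate (w, u) \<and> rate (w, u) < full_rate (w, u)" ..
      qed
    qed
  qed
  then show ?thesis by (rule QU.AE_pair_measure[rotated]) measurable
qed

text \<open>The full rate is at least the reciprocal of the encoder's weight, whose integral is at
  most one. Finiteness is what the strict comparison of integrals in \<open>ex_codebook\<close>
  requires.\<close>

lemma full_success_le_1:
  "(\<integral>\<^sup>+ p. indicator good p * ennreal (1 / full_rate p) \<partial>(Q \<Otimes>\<^sub>M U)) \<le> 1"
proof -
  have "(\<integral>\<^sup>+ p. indicator good p * ennreal (1 / full_rate p) \<partial>(Q \<Otimes>\<^sub>M U)) \<le>
      (\<integral>\<^sup>+ p. ennreal (f (\<xi> (fst p), snd p)) \<partial>(Q \<Otimes>\<^sub>M U))"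
  proof (intro nn_integral_mono)
    fix p
    show "indicator good p * ennreal (1 / full_rate p) \<le> ennreal (f (\<xi> (fst p), snd p))"
    proof (cases "p \<in> good")
      case True
      then have pos: "0 < f (\<xi> (fst p), snd p)" "0 < g (\<eta> (fst p), snd p)" by (auto simp: good_def)
      let ?a = "f (\<xi> (fst p), snd p)"
      have le: "1 / ?a \<le> full_rate p"
        unfolding full_rate_def using pos by (intro le_add_same_cancel1[THEN iffD2]) simp
      have "1 / full_rate p \<le> 1 / (1 / ?a)"
        by (rule frac_le) (use le pos in auto)
      then have "1 / full_rate p \<le> ?a" by simp
      then show ?thesis using True by (simp add: ennreal_leI)
    qed simp
  qed
  also have "\<dots> = (\<integral>\<^sup>+ w. \<integral>\<^sup>+ u. ennreal (f (\<xi> w, u)) \<partial>U \<partial>Q)"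
    using U.nn_integral_fst[of "\<lambda>p. ennreal (f (\<xi> (fst p), snd p))" Q] by simp
  also have "\<dots> \<le> (\<integral>\<^sup>+ w. 1 \<partial>Q)"
  proof (rule nn_integral_mono_AE)
    show "AE w in Q. (\<integral>\<^sup>+ u. ennreal (f (\<xi> w, u)) \<partial>U) \<le> 1"
      using f_subprob
      by eventually_elim (simp add: nn_integral_eq_integral f_nonneg)
  qed
  finally show ?thesis by (simp add: Q.emeasure_space_1)
qed

text \<open>If every codebook fell short of the target, so would all the means, and Fatou's lemma
  would bound the integral of \<open>1 / rate\<close> by that of \<open>1 / full_rate\<close>. The
  strict gap between the rates then forces \<open>good\<close> to be null, so that the target is
  zero and any codebook reaches it.\<close>

lemma ex_codebook:
  "\<exists>N \<omega>. 0 < N \<and> \<omega> \<in> space (Pi\<^sub>M {..<N} (\<lambda>_. code_point_law U M)) \<and>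
    (\<integral>\<^sup>+ p. indicator good p * ennreal (1 / full_rate p) \<partial>(Q \<Otimes>\<^sub>M U)) \<le> success N \<omega>"
proof (rule ccontr)
  let ?C = "\<lambda>N :: nat. Pi\<^sub>M {..<N} (\<lambda>_. code_point_law U M)"
  let ?target = "\<integral>\<^sup>+ p. indicator good p * ennreal (1 / full_rate p) \<partial>(Q \<Otimes>\<^sub>M U)"
  let ?\<Phi> = "\<lambda>n p. indicator good p * ennreal (real (Suc n) / (1 + real n * rate p))"
  interpret R: prob_space "code_point_law U M" by (rule prob_space_codebook)
  assume contra: "\<not> ?thesis"
  have \<Phi>_le: "(\<integral>\<^sup>+ p. ?\<Phi> n p \<partial>(Q \<Otimes>\<^sub>M U)) \<le> ?target" for n
  proof -
    interpret C: prob_space "?C (Suc n)" by (rule prob_space_PiM) (rule R.prob_space_axioms)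
    have "(\<integral>\<^sup>+ \<omega>. success (Suc n) \<omega> \<partial>?C (Suc n)) \<le> (\<integral>\<^sup>+ \<omega>. ?target \<partial>?C (Suc n))"
      using contra by (intro nn_integral_mono) (auto intro!: less_imp_le simp: not_le)
    also have "\<dots> = ?target"
      by (simp only: nn_integral_const C.emeasure_space_1 mult_1_right)
    finally show ?thesis using mean_success_ge[of n] by (rule order_trans[rotated])
  qed
  have "(\<integral>\<^sup>+ p. indicator good p * ennreal (1 / rate p) \<partial>(Q \<Otimes>\<^sub>M U)) =
      (\<integral>\<^sup>+ p. liminf (\<lambda>n. ?\<Phi> n p) \<partial>(Q \<Otimes>\<^sub>M U))"
  proof (rule nn_integral_cong_AE)
    show "AE p in Q \<Otimes>\<^sub>M U. indicator good p * ennreal (1 / rate p) = liminf (\<lambda>n. ?\<Phi> n p)"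
      using AE_rate_bounds
    proof eventually_elim
      fix p assume p: "p \<in> good \<longrightarrow> 0 < rate p \<and> rate p < full_rate p"
      have "(\<lambda>n. ?\<Phi> n p) \<longlonglongrightarrow> indicator good p * ennreal (1 / rate p)"
      proof (cases "p \<in> good")
        case True
        with p have "0 < rate p" by simp
        \<comment> \<open>Numerator and denominator are divided by \<open>n\<close>. As
          \<open>inverse 0\<close> is \<open>0\<close>, this is not an identity at
          \<open>n = 0\<close>, hence the eventual equality below.\<close>
        then have "(\<lambda>n. (1 + inverse (real n)) / (inverse (real n) + rate p)) \<longlonglongrightarrow> (1 + 0) / (0 + rate p)"
          by (intro tendsto_intros lim_inverse_n) simp
        moreover have "\<forall>\<^sub>F n in sequentially.
            (1 + inverse (real n)) / (inverse (real n) + rate p) = real (Suc n) / (1 + real n * rate p)"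
          using eventually_gt_at_top[of 0]
        proof eventually_elim
          fix n :: nat assume "0 < n"
          then have "(1 + inverse (real n)) / (inverse (real n) + rate p) =
              (real n * (1 + inverse (real n))) / (real n * (inverse (real n) + rate p))"
            by simp
          also have "\<dots> = real (Suc n) / (1 + real n * rate p)"
            using \<open>0 < n\<close> by (simp add: distrib_left)
          finally show "(1 + inverse (real n)) / (inverse (real n) + rate p) = real (Suc n) / (1 + real n * rate p)" .
        qed
        ultimately have "(\<lambda>n. real (Suc n) / (1 + real n * rate p)) \<longlonglongrightarrow> 1 / rate p"
          by (simp add: tendsto_cong)
        then have "(\<lambda>n. ennreal (real (Suc n) / (1 + real n * rate p))) \<longlonglongrightarrow> ennreal (1 / rate p)"
          by (rule tendsto_ennrealI)
        then show ?thesis using True by simp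
      qed simp
      then show "indicator good p * ennreal (1 / rate p) = liminf (\<lambda>n. ?\<Phi> n p)"
        by (intro lim_imp_Liminf[symmetric]) auto
    qed
  qed
  also have "\<dots> \<le> liminf (\<lambda>n. \<integral>\<^sup>+ p. ?\<Phi> n p \<partial>(Q \<Otimes>\<^sub>M U))"
    by (rule nn_integral_liminf) measurable
  also have "\<dots> \<le> liminf (\<lambda>n :: nat. ?target)"
    by (intro Liminf_mono always_eventually allI \<Phi>_le)
  also have "\<dots> = ?target" by (simp add: Liminf_const)
  finally have le: "(\<integral>\<^sup>+ p. indicator good p * ennreal (1 / rate p) \<partial>(Q \<Otimes>\<^sub>M U)) \<le> ?target" .
  have mono: "AE p in Q \<Otimes>\<^sub>M U. indicator good p * ennreal (1 / full_rate p) \<le> indicator good p * ennreal (1 / rate p)"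
    using AE_rate_bounds
    by eventually_elim (auto simp: indicator_def intro!: ennreal_leI divide_left_mono)
  have "AE p in Q \<Otimes>\<^sub>M U. indicator good p * ennreal (1 / rate p) \<le> indicator good p * ennreal (1 / full_rate p)"
  proof (rule ccontr)
    assume "\<not> ?thesis"
    \<comment> \<open>A strict gap on a non-null set makes the integrals differ strictly because the
      target is finite, which contradicts \<open>le\<close>.\<close>
    from neq_top_trans[OF ennreal_one_neq_top full_success_le_1] nn_integral_less[OF _ _ _ mono this]
    have "?target < (\<integral>\<^sup>+ p. indicator good p * ennreal (1 / rate p) \<partial>(Q \<Otimes>\<^sub>M U))"
      by simp
    with le show False by simp
  qed
  \<comment> \<open>On \<open>good\<close> this inequality is the reverse of a strict one, so almost
    every point lies outside \<open>good\<close>.\<close>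
  then have "AE p in Q \<Otimes>\<^sub>M U. indicator good p * ennreal (1 / full_rate p) = 0"
    using AE_rate_bounds
  proof eventually_elim
    fix p assume le: "indicator good p * ennreal (1 / rate p) \<le> indicator good p * ennreal (1 / full_rate p)"
      and p: "p \<in> good \<longrightarrow> 0 < rate p \<and> rate p < full_rate p"
    show "indicator good p * ennreal (1 / full_rate p) = 0"
    proof (cases "p \<in> good")
      case True
      with p have "1 / full_rate p < 1 / rate p" by (simp add: frac_less2)
      moreover have "1 / rate p \<le> 1 / full_rate p"
        using le True p by (simp add: ennreal_le_iff)
      ultimately show ?thesis by simp
    qed simp
  qed
  then have target_0: "?target = 0"
    by (simp add: nn_integral_0_iff_AE)
  \<comment> \<open>For target zero a codebook with a single point is enough; one exists since a
    probability space is nonempty.\<close>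
  interpret C: prob_space "?C 1" by (rule prob_space_PiM) (rule R.prob_space_axioms)
  obtain \<omega> where "\<omega> \<in> space (?C 1)" using C.not_empty by blast
  then have "0 < (1 :: nat) \<and> \<omega> \<in> space (?C 1) \<and> ?target \<le> success 1 \<omega>"
    unfolding target_0 by (intro conjI zero_less_one zero_le)
  then have ?thesis by (intro exI)
  with contra show False ..
qed

end

section \<open>Laws generated by a kernel\<close>

text \<open>The semidirect product of \<open>Q\<close> with \<open>K\<close>. Keeping
  \<open>w\<close> abstract lets the same facts serve the encoder's and the decoder's
  observation.\<close>

definition kernel_law :: "'w measure \<Rightarrow> 'u measure \<Rightarrow> ('w \<Rightarrow> 'u measure) \<Rightarrow> ('w \<times> 'u) measure" where
  "kernel_law Q U K = Q \<bind> (\<lambda>w. distr (K w) (Q \<Otimes>\<^sub>M U) (Pair w))"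

context
  fixes Q :: "'w measure" and U :: "'u measure" and K :: "'w \<Rightarrow> 'u measure"
  assumes Q: "prob_space Q" and K: "K \<in> Q \<rightarrow>\<^sub>M prob_algebra U"
begin

lemma measurable_kernel_pair:
  "(\<lambda>w. distr (K w) (Q \<Otimes>\<^sub>M U) (Pair w)) \<in> Q \<rightarrow>\<^sub>M prob_algebra (Q \<Otimes>\<^sub>M U)"
  using K by measurable

lemma sets_kernel_law [simp, measurable_cong]: "sets (kernel_law Q U K) = sets (Q \<Otimes>\<^sub>M U)"
  unfolding kernel_law_def
  using prob_space.not_empty[OF Q] by (intro sets_bind) auto

lemma prob_space_kernel_law: "prob_space (kernel_law Q U K)"
  unfolding kernel_law_def
proof (rule prob_space.prob_space_bind[OF Q])
  show "(\<lambda>w. distr (K w) (Q \<Otimes>\<^sub>M U) (Pair w)) \<in> Q \<rightarrow>\<^sub>M subprob_algebra (Q \<Otimes>\<^sub>M U)"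
    by (rule measurable_prob_algebraD[OF measurable_kernel_pair])
  show "AE w in Q. prob_space (distr (K w) (Q \<Otimes>\<^sub>M U) (Pair w))"
    using measurable_space[OF measurable_kernel_pair] by (auto simp: space_prob_algebra)
qed

lemma nn_integral_kernel_law:
  assumes h [measurable]: "h \<in> borel_measurable (Q \<Otimes>\<^sub>M U)"
  shows "(\<integral>\<^sup>+ p. h p \<partial>kernel_law Q U K) = (\<integral>\<^sup>+ w. \<integral>\<^sup>+ u. h (w, u) \<partial>K w \<partial>Q)"
proof -
  have "(\<integral>\<^sup>+ p. h p \<partial>kernel_law Q U K) =
      (\<integral>\<^sup>+ w. \<integral>\<^sup>+ p. h p \<partial>distr (K w) (Q \<Otimes>\<^sub>M U) (Pair w) \<partial>Q)"
    unfolding kernel_law_def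
    by (rule nn_integral_bind[OF h measurable_prob_algebraD[OF measurable_kernel_pair]])
  also have "\<dots> = (\<integral>\<^sup>+ w. \<integral>\<^sup>+ u. h (w, u) \<partial>K w \<partial>Q)"
  proof (rule nn_integral_cong)
    fix w assume w: "w \<in> space Q"
    then have [measurable]: "Pair w \<in> K w \<rightarrow>\<^sub>M Q \<Otimes>\<^sub>M U"
      by (simp add: measurable_cong_sets[OF sets_kernel[OF measurable_prob_algebraD[OF K] w] refl])
    show "(\<integral>\<^sup>+ p. h p \<partial>distr (K w) (Q \<Otimes>\<^sub>M U) (Pair w)) = (\<integral>\<^sup>+ u. h (w, u) \<partial>K w)"
      by (rule nn_integral_distr) measurable
  qed
  finally show ?thesis .
qed

lemma emeasure_kernel_law_Times:
  assumes E[measurable]: "E \<in> sets Q" and F[measurable]: "F \<in> sets U"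
  shows "emeasure (kernel_law Q U K) (E \<times> F) = (\<integral>\<^sup>+ w\<in>E. emeasure (K w) F \<partial>Q)"
proof -
  have "emeasure (kernel_law Q U K) (E \<times> F) = (\<integral>\<^sup>+ p. indicator (E \<times> F) p \<partial>kernel_law Q U K)"
    by simp
  also have "\<dots> = (\<integral>\<^sup>+ w. \<integral>\<^sup>+ u. indicator (E \<times> F) (w, u) \<partial>K w \<partial>Q)"
    by (rule nn_integral_kernel_law) measurable
  also have "\<dots> = (\<integral>\<^sup>+ w\<in>E. emeasure (K w) F \<partial>Q)"
  proof (rule nn_integral_cong)
    fix w assume w: "w \<in> space Q"
    then have "F \<in> sets (K w)" using sets_kernel[OF measurable_prob_algebraD[OF K] w] F by simp
    then have "(\<integral>\<^sup>+ u. indicator E w * indicator F u \<partial>K w) = indicator E w * emeasure (K w) F"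
      by (rule nn_integral_cmult_indicator)
    then show "(\<integral>\<^sup>+ u. indicator (E \<times> F) (w, u) \<partial>K w) = emeasure (K w) F * indicator E w"
      by (simp add: indicator_times mult.commute)
  qed
  finally show ?thesis .
qed

end

section \<open>Densities of joint laws\<close>

text \<open>A density with finite integral is finite almost everywhere, and its zero set is null for
  the measure it defines. This makes \<open>log\<close> of its real value meaningful.\<close>

lemma AE_density_pos_finite:
  assumes R: "finite_measure R" and [measurable]: "f \<in> borel_measurable N" and dens: "density N f = R"
  shows "AE z in R. 0 < f z \<and> f z < \<infinity>"
proof -
  have "(\<integral>\<^sup>+ z. f z \<partial>N) = emeasure R (space R)"
    unfolding dens[symmetric] by (simp add: emeasure_density cong: nn_integral_cong)
  also have "\<dots> \<noteq> \<infinity>" using finite_measure.emeasure_finite[OF R] by simp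
  finally have "AE z in N. f z \<noteq> \<infinity>" by (intro nn_integral_noteq_infinite) auto
  then show ?thesis
    unfolding dens[symmetric] by (subst AE_density) (auto simp: less_top)
qed

text \<open>Integrating out the first variable gives a density of the second marginal with respect
  to \<open>B\<close>. The marginal is \<open>B\<close> itself, and densities are unique almost
  everywhere.\<close>

lemma AE_nn_integral_density_eq_1:
  assumes "prob_space A" "prob_space B" and [measurable]: "f \<in> borel_measurable (A \<Otimes>\<^sub>M B)"
    and marg: "distr (density (A \<Otimes>\<^sub>M B) f) B snd = B"
  shows "AE b in B. (\<integral>\<^sup>+ a. f (a, b) \<partial>A) = 1"
proof -
  interpret A: prob_space A by fact
  interpret B: prob_space B by fact
  interpret AB: pair_prob_space A B ..
  let ?h = "\<lambda>b. \<integral>\<^sup>+ a. f (a, b) \<partial>A"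
  have "density B ?h = density B (\<lambda>_. 1)"
  proof (rule measure_eqI)
    fix E assume "E \<in> sets (density B ?h)"
    then have [measurable]: "E \<in> sets B" by simp
    have "emeasure (density B ?h) E = (\<integral>\<^sup>+ b. ?h b * indicator E b \<partial>B)"
      by (rule emeasure_density) measurable
    also have "\<dots> = (\<integral>\<^sup>+ b. \<integral>\<^sup>+ a. f (a, b) * indicator E b \<partial>A \<partial>B)"
      by (intro nn_integral_cong nn_integral_multc[symmetric]) measurable
    also have "\<dots> = (\<integral>\<^sup>+ p. f p * indicator E (snd p) \<partial>(A \<Otimes>\<^sub>M B))"
      by (subst AB.nn_integral_snd[symmetric]) (simp_all add: split_beta')
    also have "\<dots> = (\<integral>\<^sup>+ p. f p * indicator (snd -` E \<inter> space (A \<Otimes>\<^sub>M B)) p \<partial>(A \<Otimes>\<^sub>M B))"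
      by (intro nn_integral_cong) (simp add: indicator_def)
    also have "\<dots> = emeasure (distr (density (A \<Otimes>\<^sub>M B) f) B snd) E"
      by (simp add: emeasure_distr emeasure_density)
    finally show "emeasure (density B ?h) E = emeasure (density B (\<lambda>_. 1)) E"
      by (simp add: marg density_1)
  qed simp
  then show ?thesis
    by (subst (asm) B.density_unique_iff) (auto simp: density_1 B.sigma_finite_measure_axioms)
qed

text \<open>Since the kernel depends on \<open>w\<close> only through \<open>\<xi> w\<close>, a density of the law of \<open>(u, \<xi> w)\<close> is
  already a density of the law of \<open>(w, u)\<close>.\<close>

lemma kernel_law_eq_density:
  fixes Q :: "'w measure" and U :: "'u measure" and X :: "'x measure"
  assumes Q: "prob_space Q" and \<xi> [measurable]: "\<xi> \<in> Q \<rightarrow>\<^sub>M X" and K: "K \<in> X \<rightarrow>\<^sub>M prob_algebra U"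
  defines "L \<equiv> kernel_law Q U (\<lambda>w. K (\<xi> w))"
  defines "PU \<equiv> distr L U snd"
  assumes f [measurable]: "f \<in> borel_measurable (U \<Otimes>\<^sub>M X)"
    and dens: "density (PU \<Otimes>\<^sub>M distr Q X \<xi>) f = distr L (U \<Otimes>\<^sub>M X) (\<lambda>(w, u). (u, \<xi> w))"
  shows "density (Q \<Otimes>\<^sub>M PU) (\<lambda>(w, u). f (u, \<xi> w)) = L"
proof -
  interpret Q: prob_space Q by fact
  have K\<xi>: "(\<lambda>w. K (\<xi> w)) \<in> Q \<rightarrow>\<^sub>M prob_algebra U" using measurable_compose[OF \<xi> K] .
  note LK = sets_kernel_law[OF Q K\<xi>, folded L_def] prob_space_kernel_law[OF Q K\<xi>, folded L_def]
    emeasure_kernel_law_Times[OF Q K\<xi>, folded L_def]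
  note [measurable_cong] = LK(1)
  interpret L: prob_space L by (rule LK)
  define PX where "PX = distr Q X \<xi>"
  interpret PX: prob_space PX unfolding PX_def by (rule Q.prob_space_distr) measurable
  interpret PU: prob_space PU unfolding PU_def by (rule L.prob_space_distr) measurable
  interpret PUX: pair_prob_space PU PX ..
  interpret QPU: pair_prob_space Q PU ..
  have [measurable_cong]: "sets PX = sets X" "sets PU = sets U" by (simp_all add: PX_def PU_def)
  have KF [measurable]: "(\<lambda>x. emeasure (K x) F) \<in> borel_measurable X" if "F \<in> sets U" for F
    using that by (intro measurable_compose[OF measurable_prob_algebraD[OF K] measurable_emeasure_subprob_algebra])
  \<comment> \<open>For a fixed \<open>F\<close> both sides are densities, with respect to
    \<open>PX\<close>, of the law of \<open>\<xi> w\<close> restricted to \<open>u\<close> in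
    \<open>F\<close>. The null set may depend on \<open>F\<close>, which is harmless because
    rectangles are compared one at a time.\<close>
  have kernel: "AE x in PX. (\<integral>\<^sup>+ u. f (u, x) * indicator F u \<partial>PU) = emeasure (K x) F"
    if F[measurable]: "F \<in> sets U" for F
  proof -
    have "density PX (\<lambda>x. \<integral>\<^sup>+ u. f (u, x) * indicator F u \<partial>PU) = density PX (\<lambda>x. emeasure (K x) F)"
    proof (rule measure_eqI)
      fix E assume "E \<in> sets (density PX (\<lambda>x. \<integral>\<^sup>+ u. f (u, x) * indicator F u \<partial>PU))"
      then have E[measurable]: "E \<in> sets X" by (simp add: PX_def)
      have "emeasure (density PX (\<lambda>x. \<integral>\<^sup>+ u. f (u, x) * indicator F u \<partial>PU)) E =
          (\<integral>\<^sup>+ x. (\<integral>\<^sup>+ u. f (u, x) * indicator F u \<partial>PU) * indicator E x \<partial>PX)"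
        by (rule emeasure_density) measurable
      also have "\<dots> = (\<integral>\<^sup>+ x. \<integral>\<^sup>+ u. f (u, x) * indicator (F \<times> E) (u, x) \<partial>PU \<partial>PX)"
      proof (rule nn_integral_cong)
        fix x assume "x \<in> space PX"
        then have [measurable]: "x \<in> space X" by (simp add: PX_def)
        have "(\<integral>\<^sup>+ u. f (u, x) * indicator F u * indicator E x \<partial>PU) =
            (\<integral>\<^sup>+ u. f (u, x) * indicator F u \<partial>PU) * indicator E x"
          by (rule nn_integral_multc) measurable
        then show "(\<integral>\<^sup>+ u. f (u, x) * indicator F u \<partial>PU) * indicator E x =
            (\<integral>\<^sup>+ u. f (u, x) * indicator (F \<times> E) (u, x) \<partial>PU)"
          by (simp add: indicator_times mult.assoc)
      qed
      also have "\<dots> = (\<integral>\<^sup>+ p. f p * indicator (F \<times> E) p \<partial>(PU \<Otimes>\<^sub>M PX))"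
        by (subst PUX.nn_integral_snd[symmetric]) (simp_all add: split_beta')
      also have "\<dots> = emeasure (density (PU \<Otimes>\<^sub>M PX) f) (F \<times> E)"
        by (rule emeasure_density[symmetric]) measurable
      also have "\<dots> = emeasure L ((\<xi> -` E \<inter> space Q) \<times> F)"
        using sets.sets_into_space[OF F] sets_eq_imp_space_eq[OF LK(1)]
        unfolding dens[folded PX_def]
        by (subst emeasure_distr) (auto intro!: arg_cong2[where f = emeasure] simp: space_pair_measure)
      also have "\<dots> = (\<integral>\<^sup>+ w. emeasure (K (\<xi> w)) F * indicator E (\<xi> w) \<partial>Q)"
        by (subst LK(3)) (auto intro!: nn_integral_cong simp: indicator_def)
      also have "\<dots> = (\<integral>\<^sup>+ x. emeasure (K x) F * indicator E x \<partial>PX)"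
        unfolding PX_def by (rule nn_integral_distr[symmetric]) measurable
      also have "\<dots> = emeasure (density PX (\<lambda>x. emeasure (K x) F)) E"
        by (rule emeasure_density[symmetric]) measurable
      finally show "emeasure (density PX (\<lambda>x. \<integral>\<^sup>+ u. f (u, x) * indicator F u \<partial>PU)) E =
        emeasure (density PX (\<lambda>x. emeasure (K x) F)) E" .
    qed simp
    \<comment> \<open>Uniqueness of densities needs a sigma-finite measure; this one is finite since
      the kernel masses are at most one.\<close>
    moreover have "sigma_finite_measure (density PX (\<lambda>x. emeasure (K x) F))"
    proof -
      have "emeasure (density PX (\<lambda>x. emeasure (K x) F)) (space PX) = (\<integral>\<^sup>+ x. emeasure (K x) F \<partial>PX)"
        by (simp add: emeasure_density cong: nn_integral_cong)
      also have "\<dots> \<le> (\<integral>\<^sup>+ x. 1 \<partial>PX)"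
      proof (rule nn_integral_mono)
        fix x assume "x \<in> space PX"
        then interpret Kx: prob_space "K x"
          using measurable_space[OF K] by (auto simp: space_prob_algebra PX_def)
        show "emeasure (K x) F \<le> 1" by (rule Kx.emeasure_le_1)
      qed
      finally have "finite_measure (density PX (\<lambda>x. emeasure (K x) F))"
        by (intro finite_measureI) (auto simp: PX.emeasure_space_1 top_unique)
      then show ?thesis by (rule finite_measure.axioms(1))
    qed
    ultimately show ?thesis by (subst (asm) PX.density_unique_iff) auto
  qed
  let ?D = "density (Q \<Otimes>\<^sub>M PU) (\<lambda>(w, u). f (u, \<xi> w))"
  have rect: "emeasure ?D (E \<times> F) = emeasure L (E \<times> F)" if E[measurable]: "E \<in> sets Q" and F[measurable]: "F \<in> sets U" for E F
  proof -
    have "emeasure ?D (E \<times> F) = (\<integral>\<^sup>+ p. (case p of (w, u) \<Rightarrow> f (u, \<xi> w)) * indicator (E \<times> F) p \<partial>(Q \<Otimes>\<^sub>M PU))"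
      by (rule emeasure_density) measurable
    also have "\<dots> = (\<integral>\<^sup>+ w. \<integral>\<^sup>+ u. f (u, \<xi> w) * indicator (E \<times> F) (w, u) \<partial>PU \<partial>Q)"
      by (subst PU.nn_integral_fst[symmetric]) simp_all
    also have "\<dots> = (\<integral>\<^sup>+ w. (\<integral>\<^sup>+ u. f (u, \<xi> w) * indicator F u \<partial>PU) * indicator E w \<partial>Q)"
      by (intro nn_integral_cong) (auto simp: indicator_times split: split_indicator)
    also have "\<dots> = (\<integral>\<^sup>+ w\<in>E. emeasure (K (\<xi> w)) F \<partial>Q)"
    proof (rule nn_integral_cong_AE)
      have "AE w in Q. (\<integral>\<^sup>+ u. f (u, \<xi> w) * indicator F u \<partial>PU) = emeasure (K (\<xi> w)) F"
        using kernel[OF F] unfolding PX_def by (rule AE_distrD[rotated]) measurable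
      then show "AE w in Q. (\<integral>\<^sup>+ u. f (u, \<xi> w) * indicator F u \<partial>PU) * indicator E w
          = emeasure (K (\<xi> w)) F * indicator E w"
        by eventually_elim simp
    qed
    also have "\<dots> = emeasure L (E \<times> F)" by (rule LK(3)[symmetric]) fact+
    finally show ?thesis .
  qed
  have sets_QPU: "sets (Q \<Otimes>\<^sub>M PU) = sets (Q \<Otimes>\<^sub>M U)"
    by (rule sets_pair_measure_cong) (simp_all add: PU_def)
  show ?thesis
  proof (rule measure_eqI_generator_eq[OF Int_stable_pair_measure_generator,
        where A = "\<lambda>_. space Q \<times> space U"])
    show "{E \<times> F | E F. E \<in> sets Q \<and> F \<in> sets U} \<subseteq> Pow (space Q \<times> space U)"
      by (rule pair_measure_closed)
    show "emeasure ?D Z = emeasure L Z" if "Z \<in> {E \<times> F | E F. E \<in> sets Q \<and> F \<in> sets U}" for Z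
      using that rect by auto
    show "sets ?D = sigma_sets (space Q \<times> space U) {E \<times> F | E F. E \<in> sets Q \<and> F \<in> sets U}"
      unfolding sets_density sets_QPU by (rule sets_pair_measure)
    show "sets L = sigma_sets (space Q \<times> space U) {E \<times> F | E F. E \<in> sets Q \<and> F \<in> sets U}"
      by (simp add: LK(1) sets_pair_measure)
    show "emeasure ?D (space Q \<times> space U) \<noteq> \<infinity>"
      by (subst rect) auto
  qed auto
qed

lemma distr_fst_kernel_law:
  assumes Q: "prob_space Q" and K: "K \<in> Q \<rightarrow>\<^sub>M prob_algebra U"
  shows "distr (kernel_law Q U K) Q fst = Q"
proof (rule measure_eqI)
  note LK = sets_kernel_law[OF Q K]
  note [measurable_cong] = LK
  fix E assume "E \<in> sets (distr (kernel_law Q U K) Q fst)"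
  then have E[measurable]: "E \<in> sets Q" by simp
  have "emeasure (distr (kernel_law Q U K) Q fst) E = emeasure (kernel_law Q U K) (E \<times> space U)"
    using sets.sets_into_space[OF E] sets_eq_imp_space_eq[OF LK]
    by (subst emeasure_distr) (auto intro!: arg_cong2[where f = emeasure] simp: space_pair_measure)
  also have "\<dots> = (\<integral>\<^sup>+ w\<in>E. emeasure (K w) (space U) \<partial>Q)"
    by (rule emeasure_kernel_law_Times[OF Q K]) auto
  also have "\<dots> = (\<integral>\<^sup>+ w. indicator E w \<partial>Q)"
    using in_space_prob_algebra[OF measurable_space[OF K]] by (intro nn_integral_cong) simp
  finally show "emeasure (distr (kernel_law Q U K) Q fst) E = emeasure Q E" by simp
qed simp

text \<open>The properties of the chosen density for an arbitrary observation \<zeta>, to be used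
  for both \<xi> and \<eta>. They follow once the marginals of \<open>PUZ\<close> are identified as
  the laws of \<open>u\<close> and of \<open>\<zeta> w\<close>.\<close>

lemma cond_RN_deriv_kernel_law:
  fixes Q :: "'w measure" and U :: "'u measure" and Z :: "'z measure"
  assumes Q: "prob_space Q" and K: "K \<in> Q \<rightarrow>\<^sub>M prob_algebra U" and \<zeta> [measurable]: "\<zeta> \<in> Q \<rightarrow>\<^sub>M Z"
  defines "L \<equiv> kernel_law Q U K"
  defines "PUZ \<equiv> distr L (U \<Otimes>\<^sub>M Z) (\<lambda>(w, u). (u, \<zeta> w))"
  assumes ac: "absolutely_continuous (distr L U snd \<Otimes>\<^sub>M distr Q Z \<zeta>) PUZ"
  shows "cond_RN_deriv U Z PUZ \<in> borel_measurable (U \<Otimes>\<^sub>M Z)"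
    and "density (distr L U snd \<Otimes>\<^sub>M distr Q Z \<zeta>) (cond_RN_deriv U Z PUZ) = PUZ"
    and "AE p in L. 0 < cond_RN_deriv U Z PUZ (snd p, \<zeta> (fst p)) \<and>
      cond_RN_deriv U Z PUZ (snd p, \<zeta> (fst p)) < \<infinity>"
    and "AE w in Q. (\<integral>\<^sup>+ u. cond_RN_deriv U Z PUZ (u, \<zeta> w) \<partial>distr L U snd) = 1"
proof -
  let ?f = "cond_RN_deriv U Z PUZ" and ?PU = "distr L U snd" and ?PZ = "distr Q Z \<zeta>"
  interpret Q: prob_space Q by fact
  interpret L: prob_space L unfolding L_def by (rule prob_space_kernel_law[OF Q K])
  have sets_L [measurable_cong]: "sets L = sets (Q \<Otimes>\<^sub>M U)"
    unfolding L_def by (rule sets_kernel_law[OF Q K])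
  have m [measurable]: "(\<lambda>(w, u). (u, \<zeta> w)) \<in> L \<rightarrow>\<^sub>M U \<Otimes>\<^sub>M Z" by measurable
  interpret PUZ: prob_space PUZ unfolding PUZ_def by (rule L.prob_space_distr[OF m])
  interpret PU: prob_space ?PU by (rule L.prob_space_distr) measurable
  interpret PZ: prob_space ?PZ by (rule Q.prob_space_distr) measurable
  have fst_PUZ: "distr PUZ U fst = ?PU"
    unfolding PUZ_def by (subst distr_distr) (auto simp: comp_def split_beta')
  have snd_PUZ: "distr PUZ Z snd = ?PZ"
  proof -
    have "distr PUZ Z snd = distr (distr L Q fst) Z \<zeta>"
      unfolding PUZ_def by (subst (1 2) distr_distr) (auto simp: comp_def split_beta')
    then show ?thesis unfolding L_def by (simp add: distr_fst_kernel_law[OF Q K])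
  qed
  have sets_PUZ: "sets PUZ = sets (U \<Otimes>\<^sub>M Z)" by (simp add: PUZ_def)
  \<comment> \<open>Absolute continuity provides a version, so the choice in
    \<open>cond_RN_deriv\<close> picks one.\<close>
  have RN: "is_cond_RN_deriv U Z PUZ ?f"
    unfolding cond_RN_deriv_def
    using ex_is_cond_RN_deriv[OF PUZ.prob_space_axioms sets_PUZ] ac
    unfolding fst_PUZ snd_PUZ by (intro someI_ex[of "is_cond_RN_deriv U Z PUZ"]) simp
  then show f [measurable]: "?f \<in> borel_measurable (U \<Otimes>\<^sub>M Z)"
    by (simp add: is_cond_RN_deriv_def)
  show dens: "density (?PU \<Otimes>\<^sub>M ?PZ) ?f = PUZ"
    using is_cond_RN_deriv_density[OF PUZ.prob_space_axioms sets_PUZ RN]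
    unfolding fst_PUZ snd_PUZ .
  have "AE z in PUZ. 0 < ?f z \<and> ?f z < \<infinity>"
    by (rule AE_density_pos_finite[OF PUZ.finite_measure_axioms _ dens]) measurable
  from AE_distrD[OF m this[unfolded PUZ_def]]
  show "AE p in L. 0 < ?f (snd p, \<zeta> (fst p)) \<and> ?f (snd p, \<zeta> (fst p)) < \<infinity>"
    by (simp add: split_beta' PUZ_def)
  have "AE z in ?PZ. (\<integral>\<^sup>+ u. ?f (u, z) \<partial>?PU) = 1"
  proof (rule AE_nn_integral_density_eq_1[OF PU.prob_space_axioms PZ.prob_space_axioms])
    show "?f \<in> borel_measurable (?PU \<Otimes>\<^sub>M ?PZ)" by measurable
    have "distr PUZ ?PZ snd = distr PUZ Z snd" by (rule distr_cong) simp_all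
    then show "distr (density (?PU \<Otimes>\<^sub>M ?PZ) ?f) ?PZ snd = ?PZ"
      unfolding dens snd_PUZ .
  qed
  then show "AE w in Q. (\<integral>\<^sup>+ u. ?f (u, \<zeta> w) \<partial>?PU) = 1"
    by (rule AE_distrD[OF \<zeta>])
qed

text \<open>\<open>enn2real\<close> sends infinity to zero and keeps all other values, so the
  integral can only decrease.\<close>

lemma subprob_enn2real:
  assumes [measurable]: "f \<in> borel_measurable U" and f: "(\<integral>\<^sup>+ u. f u \<partial>U) = 1"
  shows "integrable U (\<lambda>u. enn2real (f u)) \<and> (\<integral>u. enn2real (f u) \<partial>U) \<le> 1"
proof -
  have "(\<integral>\<^sup>+ u. ennreal (enn2real (f u)) \<partial>U) \<le> (\<integral>\<^sup>+ u. f u \<partial>U)"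
    by (intro nn_integral_mono) (simp add: ennreal_enn2real_if)
  with f have le: "(\<integral>\<^sup>+ u. ennreal (enn2real (f u)) \<partial>U) \<le> 1" by simp
  then have int: "integrable U (\<lambda>u. enn2real (f u))"
    by (intro integrableI_nonneg) (auto intro: le_less_trans)
  with le show ?thesis by (simp add: nn_integral_eq_integral)
qed

section \<open>The coding theorem\<close>

text \<open>The races are run with the real-valued densities as weights. A change of measure from
  \<open>L\<close> to \<open>Q\<close> times \<open>PU\<close> turns the claimed expectation into
  the target of \<open>ex_codebook\<close>.\<close>

lemma one_shot_matching:
  fixes Q :: "'w measure" and U :: "'u measure" and X :: "'x measure" and Y :: "'y measure"
  assumes Q: "prob_space Q" and \<xi> [measurable]: "\<xi> \<in> Q \<rightarrow>\<^sub>M X" and \<eta> [measurable]: "\<eta> \<in> Q \<rightarrow>\<^sub>M Y"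
    and K: "K \<in> X \<rightarrow>\<^sub>M prob_algebra U" and M: "1 \<le> M" and G: "G \<in> sets (Q \<Otimes>\<^sub>M U)"
  defines "L \<equiv> kernel_law Q U (\<lambda>w. K (\<xi> w))"
  defines "PU \<equiv> distr L U snd"
  defines "PUX \<equiv> distr L (U \<Otimes>\<^sub>M X) (\<lambda>(w, u). (u, \<xi> w))"
  defines "PUY \<equiv> distr L (U \<Otimes>\<^sub>M Y) (\<lambda>(w, u). (u, \<eta> w))"
  assumes acX: "absolutely_continuous (PU \<Otimes>\<^sub>M distr Q X \<xi>) PUX"
    and acY: "absolutely_continuous (PU \<Otimes>\<^sub>M distr Q Y \<eta>) PUY"
  shows "\<exists>\<phi> dec. \<phi> \<in> X \<rightarrow>\<^sub>M count_space {1..M} \<and> dec \<in> count_space {1..M} \<Otimes>\<^sub>M Y \<rightarrow>\<^sub>M U \<and>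
    (\<integral>\<^sup>+ p. indicator G p * ennreal (inverse (1 + inverse (real M) *
        2 powr (info_density U X PUX (snd p) (\<xi> (fst p)) - info_density U Y PUY (snd p) (\<eta> (fst p))))) \<partial>L)
    \<le> emeasure Q {w \<in> space Q. (w, dec (\<phi> (\<xi> w), \<eta> w)) \<in> G}"
proof -
  have K\<xi>: "(\<lambda>w. K (\<xi> w)) \<in> Q \<rightarrow>\<^sub>M prob_algebra U" using measurable_compose[OF \<xi> K] .
  interpret Q: prob_space Q by fact
  interpret L: prob_space L unfolding L_def by (rule prob_space_kernel_law[OF Q K\<xi>])
  have sets_L [measurable_cong]: "sets L = sets (Q \<Otimes>\<^sub>M U)"
    unfolding L_def by (rule sets_kernel_law[OF Q K\<xi>])
  have [measurable_cong]: "sets PU = sets U" by (simp add: PU_def)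
  have sets_QPU: "sets (Q \<Otimes>\<^sub>M PU) = sets (Q \<Otimes>\<^sub>M U)"
    by (rule sets_pair_measure_cong) (simp_all add: PU_def)
  interpret PU: prob_space PU unfolding PU_def by (rule L.prob_space_distr) measurable
  define fX fY where "fX = cond_RN_deriv U X PUX" and "fY = cond_RN_deriv U Y PUY"
  note X = cond_RN_deriv_kernel_law[OF Q K\<xi> \<xi>, folded L_def, folded PU_def PUX_def, OF acX, folded fX_def]
  note Y = cond_RN_deriv_kernel_law[OF Q K\<xi> \<eta>, folded L_def, folded PU_def PUY_def, OF acY, folded fY_def]
  note [measurable] = X(1) Y(1)
  \<comment> \<open>The set \<open>G\<close> involves all of \<open>w\<close>, so the density of the
    law of \<open>u\<close> and \<open>\<xi> w\<close> has to be lifted to the law of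
    \<open>w\<close> and \<open>u\<close>.\<close>
  have L_dens: "density (Q \<Otimes>\<^sub>M PU) (\<lambda>(w, u). fX (u, \<xi> w)) = L"
    using kernel_law_eq_density[OF Q \<xi> K X(1), folded L_def, folded PU_def, folded PUX_def, OF X(2)] .
  let ?f = "\<lambda>(x, u). enn2real (fX (u, x))" and ?g = "\<lambda>(y, u). enn2real (fY (u, y))"
  interpret mp: matching_problem Q PU X Y \<xi> \<eta> ?f ?g M G
  proof
    show "AE w in Q. integrable PU (\<lambda>u. ?f (\<xi> w, u)) \<and> (\<integral>u. ?f (\<xi> w, u) \<partial>PU) \<le> 1"
      using X(4) AE_space
    proof eventually_elim
      fix w assume 1: "(\<integral>\<^sup>+ u. fX (u, \<xi> w) \<partial>PU) = 1" and [measurable]: "w \<in> space Q"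
      have "(\<lambda>u. fX (u, \<xi> w)) \<in> borel_measurable PU" by measurable
      from subprob_enn2real[OF this 1]
      show "integrable PU (\<lambda>u. ?f (\<xi> w, u)) \<and> (\<integral>u. ?f (\<xi> w, u) \<partial>PU) \<le> 1" by simp
    qed
    show "AE w in Q. integrable PU (\<lambda>u. ?g (\<eta> w, u)) \<and> (\<integral>u. ?g (\<eta> w, u) \<partial>PU) \<le> 1"
      using Y(4) AE_space
    proof eventually_elim
      fix w assume 1: "(\<integral>\<^sup>+ u. fY (u, \<eta> w) \<partial>PU) = 1" and [measurable]: "w \<in> space Q"
      have "(\<lambda>u. fY (u, \<eta> w)) \<in> borel_measurable PU" by measurable
      from subprob_enn2real[OF this 1]
      show "integrable PU (\<lambda>u. ?g (\<eta> w, u)) \<and> (\<integral>u. ?g (\<eta> w, u) \<partial>PU) \<le> 1" by simp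
    qed
    show "?f \<in> borel_measurable (X \<Otimes>\<^sub>M PU)" "?g \<in> borel_measurable (Y \<Otimes>\<^sub>M PU)"
      by measurable
    show "G \<in> sets (Q \<Otimes>\<^sub>M PU)" using G sets_QPU by simp
  qed (use M in \<open>auto split: prod.split\<close>)
  obtain N \<omega> where N: "0 < N" and \<omega>: "\<omega> \<in> space (Pi\<^sub>M {..<N} (\<lambda>_. code_point_law PU M))"
    and succ: "(\<integral>\<^sup>+ p. indicator mp.good p * ennreal (1 / mp.full_rate p) \<partial>(Q \<Otimes>\<^sub>M PU)) \<le> mp.success N \<omega>"
    using mp.ex_codebook by blast
  have \<omega>k: "\<omega> k \<in> space (code_point_law PU M)" if "k < N" for k
    using \<omega> that by (auto simp: space_PiM)
  let ?h = "\<lambda>p. indicator G p * ennreal (inverse (1 + inverse (real M) *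
        2 powr (info_density U X PUX (snd p) (\<xi> (fst p)) - info_density U Y PUY (snd p) (\<eta> (fst p)))))"
  have [measurable]: "G \<in> sets (Q \<Otimes>\<^sub>M U)" by fact
  have h_meas [measurable]: "?h \<in> borel_measurable (Q \<Otimes>\<^sub>M U)"
    unfolding info_density_def fX_def[symmetric] fY_def[symmetric] by measurable
  have "(\<integral>\<^sup>+ p. ?h p \<partial>L) = (\<integral>\<^sup>+ p. fX (snd p, \<xi> (fst p)) * ?h p \<partial>(Q \<Otimes>\<^sub>M PU))"
    unfolding L_dens[symmetric] by (subst nn_integral_density) (simp_all add: split_beta')
  also have "\<dots> \<le> (\<integral>\<^sup>+ p. indicator mp.good p * ennreal (1 / mp.full_rate p) \<partial>(Q \<Otimes>\<^sub>M PU))"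
  proof (rule nn_integral_mono_AE)
    \<comment> \<open>What holds almost everywhere under \<open>L\<close> carries over to the
      product measure only where the density of \<open>L\<close> is positive; elsewhere the
      integrand vanishes.\<close>
    have "AE p in Q \<Otimes>\<^sub>M PU. 0 < fX (snd p, \<xi> (fst p)) \<longrightarrow>
        fX (snd p, \<xi> (fst p)) < \<infinity> \<and> 0 < fY (snd p, \<eta> (fst p)) \<and> fY (snd p, \<eta> (fst p)) < \<infinity>"
    proof -
      have "AE p in L. (0 < fX (snd p, \<xi> (fst p)) \<and> fX (snd p, \<xi> (fst p)) < \<infinity>) \<and>
          0 < fY (snd p, \<eta> (fst p)) \<and> fY (snd p, \<eta> (fst p)) < \<infinity>"
        using X(3) Y(3) by eventually_elim simp
      then have "AE p in Q \<Otimes>\<^sub>M PU. 0 < (case p of (w, u) \<Rightarrow> fX (u, \<xi> w)) \<longrightarrow>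
        (0 < fX (snd p, \<xi> (fst p)) \<and> fX (snd p, \<xi> (fst p)) < \<infinity>) \<and>
          0 < fY (snd p, \<eta> (fst p)) \<and> fY (snd p, \<eta> (fst p)) < \<infinity>"
        unfolding L_dens[symmetric] by (subst (asm) AE_density) measurable
      then show ?thesis by eventually_elim (auto simp: split_beta')
    qed
    then show "AE p in Q \<Otimes>\<^sub>M PU. fX (snd p, \<xi> (fst p)) * ?h p \<le> indicator mp.good p * ennreal (1 / mp.full_rate p)"
    proof eventually_elim
      fix p assume fin: "0 < fX (snd p, \<xi> (fst p)) \<longrightarrow>
        fX (snd p, \<xi> (fst p)) < \<infinity> \<and> 0 < fY (snd p, \<eta> (fst p)) \<and> fY (snd p, \<eta> (fst p)) < \<infinity>"
      show "fX (snd p, \<xi> (fst p)) * ?h p \<le> indicator mp.good p * ennreal (1 / mp.full_rate p)"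
      proof (cases "p \<in> G \<and> 0 < fX (snd p, \<xi> (fst p))")
        case False
        then show ?thesis by (cases "p \<in> G") (auto simp: zero_less_iff_neq_zero)
      next
        case True
        define a b where "a = enn2real (fX (snd p, \<xi> (fst p)))" and "b = enn2real (fY (snd p, \<eta> (fst p)))"
        have pos: "0 < a" "0 < b" using True fin by (auto simp: a_def b_def enn2real_positive_iff)
        have fX: "fX (snd p, \<xi> (fst p)) = ennreal a" using True fin by (simp add: a_def)
        have "2 powr (log 2 a - log 2 b) = a / b"
          using pos by (simp add: powr_diff)
        then have "?h p = ennreal (inverse (1 + inverse (real M) * (a / b)))"
          using True by (simp add: info_density_def fX_def[symmetric] fY_def[symmetric] a_def b_def)
        moreover have "mp.full_rate p = 1 / a + 1 / b / real M"
          by (simp add: mp.full_rate_def a_def b_def)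
        moreover have "p \<in> mp.good" using True pos by (simp add: mp.good_def a_def b_def)
        \<comment> \<open>The factor \<open>a\<close> from the change of measure cancels, leaving
          the reciprocal of the full rate.\<close>
        moreover have "a * inverse (1 + inverse (real M) * (a / b)) = 1 / (1 / a + 1 / b / real M)"
        proof -
          have eq: "1 + inverse (real M) * (a / b) = (1 / a + 1 / b / real M) * a"
            using pos by (simp add: distrib_right field_simps)
          have "a * inverse (c * a) = 1 / c" for c :: real
            using pos by (simp add: divide_inverse)
          then show ?thesis unfolding eq .
        qed
        ultimately show ?thesis
          using pos by (simp add: fX ennreal_mult'[symmetric])
      qed
    qed
  qed
  also note succ
  finally have "(\<integral>\<^sup>+ p. ?h p \<partial>L) \<le> mp.success N \<omega>" .
  moreover have "race_encoder N ?f \<omega> \<in> X \<rightarrow>\<^sub>M count_space {1..M}"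
    by (rule measurable_race_encoder[OF mp.measurable_weights(1) N \<omega>k])
  moreover have "race_decoder N ?g \<omega> \<in> count_space {1..M} \<Otimes>\<^sub>M Y \<rightarrow>\<^sub>M U"
    using measurable_race_decoder[OF mp.measurable_weights(2) N \<omega>k]
    unfolding measurable_cong_sets[OF refl \<open>sets PU = sets U\<close>] .
  ultimately show ?thesis unfolding mp.success_def by blast
qed

section \<open>Distortions and laws of sequences\<close>

lemma measurable_seq_dist:
  assumes d: "case_prod d \<in> borel_measurable (A \<Otimes>\<^sub>M B)"
    and a: "a \<in> L \<rightarrow>\<^sub>M seq_space n A" and b: "b \<in> L \<rightarrow>\<^sub>M seq_space n B"
  shows "(\<lambda>p. seq_dist n d (a p) (b p)) \<in> borel_measurable L"
proof -
  have "(\<lambda>p. d (a p i) (b p i)) \<in> borel_measurable L" if "i < n" for i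
  proof -
    have "(\<lambda>p. a p i) \<in> L \<rightarrow>\<^sub>M A" "(\<lambda>p. b p i) \<in> L \<rightarrow>\<^sub>M B"
      using that measurable_compose[OF a[unfolded seq_space_def] measurable_component_singleton]
        measurable_compose[OF b[unfolded seq_space_def] measurable_component_singleton] by auto
    from measurable_compose[OF measurable_Pair[OF this] d] show ?thesis by simp
  qed
  then show ?thesis unfolding seq_dist_def by (intro borel_measurable_divide borel_measurable_sum) auto
qed

lemma
  assumes P: "prob_space P" and sets_P: "sets P = sets (S \<Otimes>\<^sub>M X \<Otimes>\<^sub>M Y)"
  shows prob_space_source_law: "prob_space (source_law n S X Y P)"
    and sets_source_law: "sets (source_law n S X Y P) =
      sets (seq_space n S \<Otimes>\<^sub>M seq_space n X \<Otimes>\<^sub>M seq_space n Y)"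
proof -
  have [measurable]: "fst \<in> P \<rightarrow>\<^sub>M S" "(\<lambda>p. fst (snd p)) \<in> P \<rightarrow>\<^sub>M X" "(\<lambda>p. snd (snd p)) \<in> P \<rightarrow>\<^sub>M Y"
    unfolding measurable_cong_sets[OF sets_P refl] by measurable
  have comp: "(\<lambda>\<omega>. \<lambda>i\<in>{..<n}. h (\<omega> i)) \<in> seq_space n P \<rightarrow>\<^sub>M seq_space n A" if "h \<in> P \<rightarrow>\<^sub>M A"
    for h and A :: "'d measure"
    unfolding seq_space_def
  proof (rule measurable_restrict)
    fix i assume "i \<in> {..<n}"
    from measurable_compose[OF measurable_component_singleton[OF this, of "\<lambda>_. P"] that]
    show "(\<lambda>\<omega>. h (\<omega> i)) \<in> Pi\<^sub>M {..<n} (\<lambda>_. P) \<rightarrow>\<^sub>M A" .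
  qed
  show "prob_space (source_law n S X Y P)"
    unfolding source_law_def
    by (intro prob_space.prob_space_distr measurable_Pair comp)
      (auto simp: seq_space_def intro!: prob_space_PiM P)
qed (simp add: source_law_def)

text \<open>The two laws differ only in how the tuple is bracketed. The regrouping map is pushed
  through the bind, and a bind into point masses is a pushforward.\<close>

lemma aux_law_eq_distr_kernel_law:
  assumes P: "prob_space P" and sets_P: "sets P = sets (S \<Otimes>\<^sub>M X \<Otimes>\<^sub>M Y)"
    and K: "K \<in> seq_space n X \<rightarrow>\<^sub>M prob_algebra (seq_space n U)"
  shows "aux_law n S X Y U P K =
    distr (kernel_law (source_law n S X Y P) (seq_space n U) (\<lambda>w. K (fst (snd w))))
      (seq_space n S \<Otimes>\<^sub>M seq_space n X \<Otimes>\<^sub>M seq_space n Y \<Otimes>\<^sub>M seq_space n U)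
      (\<lambda>((s, x, y), u). (s, x, y, u))"
proof -
  let ?Q = "source_law n S X Y P" and ?U = "seq_space n U"
  let ?T = "seq_space n S \<Otimes>\<^sub>M seq_space n X \<Otimes>\<^sub>M seq_space n Y \<Otimes>\<^sub>M ?U"
  let ?a = "\<lambda>((s, x, y), u). (s, x, y, u)"
  note Q = prob_space_source_law[OF P sets_P, of n] sets_source_law[OF P sets_P, of n]
  interpret Q: prob_space ?Q by (rule Q)
  note [measurable_cong] = Q(2)
  have a: "?a \<in> ?Q \<Otimes>\<^sub>M ?U \<rightarrow>\<^sub>M ?T"
  proof -
    have "?a = (\<lambda>p. (fst (fst p), fst (snd (fst p)), snd (snd (fst p)), snd p))" by auto
    also have "\<dots> \<in> ?Q \<Otimes>\<^sub>M ?U \<rightarrow>\<^sub>M ?T" by measurable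
    finally show ?thesis .
  qed
  have \<xi>: "(\<lambda>w. fst (snd w)) \<in> ?Q \<rightarrow>\<^sub>M seq_space n X" by measurable
  have K': "(\<lambda>w. K (fst (snd w))) \<in> ?Q \<rightarrow>\<^sub>M prob_algebra ?U"
    by (rule measurable_compose[OF \<xi> K])
  note sub = measurable_prob_algebraD[OF measurable_kernel_pair[OF Q(1) K']]
  have "distr (kernel_law ?Q ?U (\<lambda>w. K (fst (snd w)))) ?T ?a =
      ?Q \<bind> (\<lambda>w. distr (distr (K (fst (snd w))) (?Q \<Otimes>\<^sub>M ?U) (Pair w)) ?T ?a)"
    unfolding kernel_law_def by (rule distr_bind[OF sub Q.not_empty a])
  also have "\<dots> = ?Q \<bind> (\<lambda>(s, x, y). K x \<bind> (\<lambda>u. return ?T (s, x, y, u)))"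
  proof (rule bind_cong[OF refl])
    fix w assume "w \<in> space ?Q"
    obtain s x y where w: "w = (s, x, y)" by (cases w)
    have sp: "(s, x, y) \<in> space ?Q" and x: "x \<in> space (seq_space n X)"
      using \<open>w \<in> space ?Q\<close> w measurable_space[OF \<xi>] by auto
    have Kx: "prob_space (K x)" "sets (K x) = sets ?U"
      using measurable_space[OF K x] by (auto simp: space_prob_algebra)
    have p: "Pair (s, x, y) \<in> K x \<rightarrow>\<^sub>M ?Q \<Otimes>\<^sub>M ?U"
      unfolding measurable_cong_sets[OF Kx(2) refl] using sp by measurable
    have "distr (distr (K x) (?Q \<Otimes>\<^sub>M ?U) (Pair (s, x, y))) ?T ?a = distr (K x) ?T (\<lambda>u. (s, x, y, u))"
      using distr_distr[OF a p] by (simp add: comp_def)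
    also have "\<dots> = K x \<bind> (\<lambda>u. return ?T (s, x, y, u))"
      using measurable_compose[OF p a] prob_space.not_empty[OF Kx(1)]
      by (intro bind_return_distr'[symmetric]) auto
    finally show "distr (distr (K (fst (snd w))) (?Q \<Otimes>\<^sub>M ?U) (Pair w)) ?T ?a =
        (case w of (s, x, y) \<Rightarrow> K x \<bind> (\<lambda>u. return ?T (s, x, y, u)))"
      by (simp add: w)
  qed
  finally show ?thesis by (simp add: aux_law_def)
qed

text \<open>For a deterministic decoder the kernel consists of point masses, so both binds collapse
  into one pushforward of the source law.\<close>

lemma code_law_return:
  assumes P: "prob_space P" and sets_P: "sets P = sets (S \<Otimes>\<^sub>M X \<Otimes>\<^sub>M Y)"
    and \<phi>: "\<phi> \<in> seq_space n X \<rightarrow>\<^sub>M count_space {1..M}"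
    and h: "h \<in> count_space {1..M} \<Otimes>\<^sub>M seq_space n Y \<rightarrow>\<^sub>M seq_space n Sh \<Otimes>\<^sub>M seq_space n Xh"
  defines "T \<equiv> seq_space n S \<Otimes>\<^sub>M seq_space n X \<Otimes>\<^sub>M seq_space n Y \<Otimes>\<^sub>M seq_space n Sh \<Otimes>\<^sub>M seq_space n Xh"
  shows "code_law n S X Y Sh Xh P \<phi> (\<lambda>p. return (seq_space n Sh \<Otimes>\<^sub>M seq_space n Xh) (h p)) =
      distr (source_law n S X Y P) T (\<lambda>(s, x, y). (s, x, y, h (\<phi> x, y)))"
    and "(\<lambda>(s, x, y). (s, x, y, h (\<phi> x, y))) \<in> source_law n S X Y P \<rightarrow>\<^sub>M T"
proof -
  let ?Q = "source_law n S X Y P"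
  note Q = prob_space_source_law[OF P sets_P, of n] sets_source_law[OF P sets_P, of n]
  interpret Q: prob_space ?Q by (rule Q)
  note [measurable_cong] = Q(2)
  note [measurable] = \<phi> h
  show meas: "(\<lambda>(s, x, y). (s, x, y, h (\<phi> x, y))) \<in> ?Q \<rightarrow>\<^sub>M T"
    unfolding T_def by measurable
  have "code_law n S X Y Sh Xh P \<phi> (\<lambda>p. return (seq_space n Sh \<Otimes>\<^sub>M seq_space n Xh) (h p)) =
      ?Q \<bind> (\<lambda>w. return T (case w of (s, x, y) \<Rightarrow> (s, x, y, h (\<phi> x, y))))"
    unfolding code_law_def T_def[symmetric]
  proof (rule bind_cong[OF refl])
    fix w assume "w \<in> space ?Q"
    obtain s x y where w: "w = (s, x, y)" by (cases w)
    have sp: "s \<in> space (seq_space n S)" "x \<in> space (seq_space n X)" "y \<in> space (seq_space n Y)"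
      using \<open>w \<in> space ?Q\<close> sets_eq_imp_space_eq[OF Q(2)] by (auto simp: w space_pair_measure)
    have "(\<phi> x, y) \<in> space (count_space {1..M} \<Otimes>\<^sub>M seq_space n Y)"
      using measurable_space[OF \<phi> sp(2)] sp(3) by (simp add: space_pair_measure)
    from measurable_space[OF h this]
    have hs: "h (\<phi> x, y) \<in> space (seq_space n Sh \<Otimes>\<^sub>M seq_space n Xh)" .
    have "(\<lambda>(sh, xh). return T (s, x, y, sh, xh)) \<in> seq_space n Sh \<Otimes>\<^sub>M seq_space n Xh \<rightarrow>\<^sub>M subprob_algebra T"
      unfolding T_def using sp by measurable
    from bind_return[OF this hs]
    show "(case w of (s, x, y) \<Rightarrow> return (seq_space n Sh \<Otimes>\<^sub>M seq_space n Xh) (h (\<phi> x, y)) \<bind>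
        (\<lambda>(sh, xh). return T (s, x, y, sh, xh))) = return T (case w of (s, x, y) \<Rightarrow> (s, x, y, h (\<phi> x, y)))"
      by (simp add: w split_beta')
  qed
  also have "\<dots> = distr ?Q T (\<lambda>(s, x, y). (s, x, y, h (\<phi> x, y)))"
    by (rule bind_return_distr'[OF Q.not_empty meas])
  finally show "code_law n S X Y Sh Xh P \<phi> (\<lambda>p. return (seq_space n Sh \<Otimes>\<^sub>M seq_space n Xh) (h p)) =
      distr ?Q T (\<lambda>(s, x, y). (s, x, y, h (\<phi> x, y)))" .
qed

text \<open>The triple of sequences is treated as a single outcome \<open>w\<close> in
  \<open>one_shot_matching\<close>, with \<open>G\<close> the event that \<open>g\<close> meets both
  thresholds. It remains to translate the laws and to pass from success to error
  probability.\<close>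

theorem theorem2:
  fixes S :: "'s measure" and X :: "'x measure" and Y :: "'y measure"
    and Sh :: "'sh measure" and Xh :: "'xh measure"
    and P :: "('s \<times> 'x \<times> 'y) measure"
    and ds :: "'s \<Rightarrow> 'sh \<Rightarrow> real" and d :: "'x \<Rightarrow> 'xh \<Rightarrow> real"
    and n M :: nat and R D Ds :: real
    and Us :: "(nat \<Rightarrow> 'u::polish_space) measure"
    and K :: "(nat \<Rightarrow> 'x) \<Rightarrow> (nat \<Rightarrow> 'u) measure"
    and g :: "(nat \<Rightarrow> 'u) \<times> (nat \<Rightarrow> 'y) \<Rightarrow> (nat \<Rightarrow> 'sh) \<times> (nat \<Rightarrow> 'xh)"
    and J :: "((nat \<Rightarrow> 's) \<times> (nat \<Rightarrow> 'x) \<times> (nat \<Rightarrow> 'y) \<times> (nat \<Rightarrow> 'u)) measure"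
    and PUX PUY PU PX PY
    and exceeds meets :: "real \<Rightarrow> real \<Rightarrow> bool"
  assumes "n \<ge> 1" and "real M = 2 powr (real n * R)"
    and "prob_space P" and "sets P = sets (S \<Otimes>\<^sub>M X \<Otimes>\<^sub>M Y)"
    and "case_prod ds \<in> borel_measurable (S \<Otimes>\<^sub>M Sh)"
    and "\<And>s sh. s \<in> space S \<Longrightarrow> sh \<in> space Sh \<Longrightarrow> 0 \<le> ds s sh"
    and "case_prod d \<in> borel_measurable (X \<Otimes>\<^sub>M Xh)"
    and "\<And>x xh. x \<in> space X \<Longrightarrow> xh \<in> space Xh \<Longrightarrow> 0 \<le> d x xh"
    and "Us = seq_space n borel"
    and "K \<in> seq_space n X \<rightarrow>\<^sub>M prob_algebra Us"
    and "g \<in> Us \<Otimes>\<^sub>M seq_space n Y \<rightarrow>\<^sub>M seq_space n Sh \<Otimes>\<^sub>M seq_space n Xh"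
    and "J = aux_law n S X Y borel P K"
    and "PUX = distr J (Us \<Otimes>\<^sub>M seq_space n X) (\<lambda>(s, x, y, u). (u, x))"
    and "PUY = distr J (Us \<Otimes>\<^sub>M seq_space n Y) (\<lambda>(s, x, y, u). (u, y))"
    and "PU = distr J Us (\<lambda>(s, x, y, u). u)"
    and "PX = distr J (seq_space n X) (\<lambda>(s, x, y, u). x)"
    and "PY = distr J (seq_space n Y) (\<lambda>(s, x, y, u). y)"
    and "absolutely_continuous (PU \<Otimes>\<^sub>M PX) PUX"
    and "absolutely_continuous (PU \<Otimes>\<^sub>M PY) PUY"
    and "(exceeds = (\<ge>) \<and> meets = (<)) \<or> (exceeds = (>) \<and> meets = (\<le>))"
  shows "\<exists>\<epsilon> \<phi> \<psi>. wyner_ziv_code exceeds S X Y Sh Xh P ds d n M D Ds \<epsilon> \<phi> \<psi> \<and>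
    \<epsilon> \<le> (\<integral>(s, x, y, u).
           (case g (u, y) of (sh, xh) \<Rightarrow>
              1 - of_bool (meets (seq_dist n ds s sh) Ds \<and> meets (seq_dist n d x xh) D)
                * inverse (1 + inverse (real M) *
                    2 powr (info_density Us (seq_space n X) PUX u x
                              - info_density Us (seq_space n Y) PUY u y))) \<partial>J)"
proof -
  note M = assms(2) and P = assms(3) and sets_P = assms(4) and ds = assms(5)
    and d = assms(7) and Us = assms(9) and K = assms(10) and g = assms(11) and J = assms(12)
    and PUX = assms(13) and PUY = assms(14) and PU = assms(15) and PX = assms(16) and PY = assms(17)
    and acX = assms(18) and acY = assms(19) and em = assms(20)
  \<comment> \<open>Both conventions for a distortion equal to its threshold are handled together,
    as success is the negation of excess.\<close>
  have ex: "exceeds a b \<longleftrightarrow> \<not> meets a b" for a b using em by auto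
  have "0 < real M" unfolding M by simp
  then have M1: "1 \<le> M" by simp
  define Q where "Q = source_law n S X Y P"
  interpret Q: prob_space Q unfolding Q_def by (rule prob_space_source_law[OF P sets_P])
  have sets_Q [measurable_cong]: "sets Q = sets (seq_space n S \<Otimes>\<^sub>M seq_space n X \<Otimes>\<^sub>M seq_space n Y)"
    unfolding Q_def by (rule sets_source_law[OF P sets_P])
  define \<xi> where "\<xi> = (\<lambda>w :: (nat \<Rightarrow> 's) \<times> (nat \<Rightarrow> 'x) \<times> (nat \<Rightarrow> 'y). fst (snd w))"
  define \<eta> where "\<eta> = (\<lambda>w :: (nat \<Rightarrow> 's) \<times> (nat \<Rightarrow> 'x) \<times> (nat \<Rightarrow> 'y). snd (snd w))"
  have \<xi> [measurable]: "\<xi> \<in> Q \<rightarrow>\<^sub>M seq_space n X" and \<eta> [measurable]: "\<eta> \<in> Q \<rightarrow>\<^sub>M seq_space n Y"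
    unfolding \<xi>_def \<eta>_def by measurable
  have K\<xi>: "(\<lambda>w. K (\<xi> w)) \<in> Q \<rightarrow>\<^sub>M prob_algebra Us" using measurable_compose[OF \<xi> K] .
  define L where "L = kernel_law Q Us (\<lambda>w. K (\<xi> w))"
  interpret L: prob_space L unfolding L_def by (rule prob_space_kernel_law[OF Q.prob_space_axioms K\<xi>])
  have sets_L [measurable_cong]: "sets L = sets (Q \<Otimes>\<^sub>M Us)"
    unfolding L_def by (rule sets_kernel_law[OF Q.prob_space_axioms K\<xi>])
  define T where "T = seq_space n S \<Otimes>\<^sub>M seq_space n X \<Otimes>\<^sub>M seq_space n Y \<Otimes>\<^sub>M Us"
  \<comment> \<open>\<open>a\<close> regroups the outcome and \<open>u\<close> into the tuple format
    of \<open>J\<close>; the map \<open>b\<close> below undoes it.\<close>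
  define a where "a = (\<lambda>p :: ((nat \<Rightarrow> 's) \<times> (nat \<Rightarrow> 'x) \<times> (nat \<Rightarrow> 'y)) \<times> (nat \<Rightarrow> 'u).
    (fst (fst p), fst (snd (fst p)), snd (snd (fst p)), snd p))"
  have a [measurable]: "a \<in> L \<rightarrow>\<^sub>M T" unfolding a_def T_def by measurable
  have J: "J = distr L T a"
    unfolding J L_def Q_def T_def a_def \<xi>_def Us
    by (subst aux_law_eq_distr_kernel_law[OF P sets_P K[unfolded Us]]) (simp add: split_beta')
  have PU: "PU = distr L Us snd"
    unfolding PU J by (subst distr_distr) (auto simp: T_def a_def comp_def split_beta')
  have PUX: "PUX = distr L (Us \<Otimes>\<^sub>M seq_space n X) (\<lambda>(w, u). (u, \<xi> w))"
    unfolding PUX J by (subst distr_distr) (auto simp: T_def a_def \<xi>_def comp_def split_beta')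
  have PUY: "PUY = distr L (Us \<Otimes>\<^sub>M seq_space n Y) (\<lambda>(w, u). (u, \<eta> w))"
    unfolding PUY J by (subst distr_distr) (auto simp: T_def a_def \<eta>_def comp_def split_beta')
  have Q_eq: "distr L Q fst = Q"
    unfolding L_def by (rule distr_fst_kernel_law[OF Q.prob_space_axioms K\<xi>])
  have "PX = distr (distr L Q fst) (seq_space n X) \<xi>"
    unfolding PX J by (subst (1 2) distr_distr) (auto simp: T_def a_def \<xi>_def comp_def split_beta')
  then have PX: "PX = distr Q (seq_space n X) \<xi>" unfolding Q_eq .
  have "PY = distr (distr L Q fst) (seq_space n Y) \<eta>"
    unfolding PY J by (subst (1 2) distr_distr) (auto simp: T_def a_def \<eta>_def comp_def split_beta')
  then have PY: "PY = distr Q (seq_space n Y) \<eta>" unfolding Q_eq .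
  define met where "met = (\<lambda>s x r. meets (seq_dist n ds s (fst r)) Ds \<and> meets (seq_dist n d x (snd r)) D)"
  have met_measurable: "Measurable.pred N (\<lambda>p. met (s p) (x p) (r p))"
    if "s \<in> N \<rightarrow>\<^sub>M seq_space n S" "x \<in> N \<rightarrow>\<^sub>M seq_space n X" "r \<in> N \<rightarrow>\<^sub>M seq_space n Sh \<Otimes>\<^sub>M seq_space n Xh"
    for N :: "'z measure" and s x r
  proof -
    have [measurable]: "(\<lambda>p. seq_dist n ds (s p) (fst (r p))) \<in> borel_measurable N"
      by (rule measurable_seq_dist[OF ds that(1) measurable_compose[OF that(3) measurable_fst]])
    have [measurable]: "(\<lambda>p. seq_dist n d (x p) (snd (r p))) \<in> borel_measurable N"
      by (rule measurable_seq_dist[OF d that(2) measurable_compose[OF that(3) measurable_snd]])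
    show ?thesis using em unfolding met_def by (elim disjE) simp_all
  qed
  define G where "G = {p \<in> space (Q \<Otimes>\<^sub>M Us). met (fst (fst p)) (\<xi> (fst p)) (g (snd p, \<eta> (fst p)))}"
  have G [measurable]: "G \<in> sets (Q \<Otimes>\<^sub>M Us)"
  proof -
    have "(\<lambda>p. (snd p, \<eta> (fst p))) \<in> Q \<Otimes>\<^sub>M Us \<rightarrow>\<^sub>M Us \<Otimes>\<^sub>M seq_space n Y" by measurable
    from measurable_compose[OF this g]
    have "Measurable.pred (Q \<Otimes>\<^sub>M Us) (\<lambda>p. met (fst (fst p)) (\<xi> (fst p)) (g (snd p, \<eta> (fst p))))"
      by (rule met_measurable[rotated 2]) measurable
    then show ?thesis unfolding G_def pred_def .
  qed
  define iX where "iX = info_density Us (seq_space n X) PUX"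
  define iY where "iY = info_density Us (seq_space n Y) PUY"
  \<comment> \<open>\<open>v\<close> is the factor that multiplies the success indicator in the
    claimed bound.\<close>
  define v where "v = (\<lambda>p. inverse (1 + inverse (real M) * 2 powr (iX (snd p) (\<xi> (fst p)) - iY (snd p) (\<eta> (fst p)))))"
  have v01: "0 \<le> v p" "v p \<le> 1" for p
    unfolding v_def by (auto intro!: add_nonneg_nonneg simp: inverse_le_1_iff)
  note matching = one_shot_matching[OF Q.prob_space_axioms \<xi> \<eta> K M1 G, folded L_def, folded PU PUX PUY,
      folded PX PY, OF acX acY, folded iX_def iY_def]
  obtain \<phi> dec where \<phi>: "\<phi> \<in> seq_space n X \<rightarrow>\<^sub>M count_space {1..M}"
    and dec: "dec \<in> count_space {1..M} \<Otimes>\<^sub>M seq_space n Y \<rightarrow>\<^sub>M Us"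
    and succ: "(\<integral>\<^sup>+ p. indicator G p * ennreal (v p) \<partial>L) \<le> emeasure Q {w \<in> space Q. (w, dec (\<phi> (\<xi> w), \<eta> w)) \<in> G}"
    using matching unfolding v_def by blast
  \<comment> \<open>The decoder first recovers an auxiliary sequence and then applies
    \<open>g\<close> to it and the side information.\<close>
  define h where "h = (\<lambda>p. g (dec p, snd p))"
  have h: "h \<in> count_space {1..M} \<Otimes>\<^sub>M seq_space n Y \<rightarrow>\<^sub>M seq_space n Sh \<Otimes>\<^sub>M seq_space n Xh"
    unfolding h_def by (rule measurable_compose[OF measurable_Pair[OF dec measurable_snd] g])
  define \<psi> where "\<psi> = (\<lambda>p. return (seq_space n Sh \<Otimes>\<^sub>M seq_space n Xh) (h p))"
  have \<psi>: "\<psi> \<in> count_space {1..M} \<Otimes>\<^sub>M seq_space n Y \<rightarrow>\<^sub>M prob_algebra (seq_space n Sh \<Otimes>\<^sub>M seq_space n Xh)"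
    unfolding \<psi>_def by (rule measurable_compose[OF h measurable_return_prob_space])
  define C where "C = code_law n S X Y Sh Xh P \<phi> \<psi>"
  define T' where "T' = seq_space n S \<Otimes>\<^sub>M seq_space n X \<Otimes>\<^sub>M seq_space n Y \<Otimes>\<^sub>M seq_space n Sh \<Otimes>\<^sub>M seq_space n Xh"
  \<comment> \<open>\<epsilon> is taken to be the exact error probability, so the code property
    holds with equality.\<close>
  define \<epsilon> where "\<epsilon> = \<P>((s, x, y, sh, xh) in C. exceeds (seq_dist n ds s sh) Ds \<or> exceeds (seq_dist n d x xh) D)"
  define good where "good = {w \<in> space Q. (w, dec (\<phi> (\<xi> w), \<eta> w)) \<in> G}"
  have dec_meas: "(\<lambda>w. dec (\<phi> (\<xi> w), \<eta> w)) \<in> Q \<rightarrow>\<^sub>M Us"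
    by (rule measurable_compose[OF measurable_Pair[OF measurable_compose[OF \<xi> \<phi>] \<eta>] dec])
  have good [measurable]: "good \<in> sets Q"
    unfolding good_def using dec_meas by measurable
  have \<epsilon>: "\<epsilon> = 1 - measure Q good"
  proof -
    let ?m = "\<lambda>(s, x, y). (s, x, y, h (\<phi> x, y))"
    have C: "C = distr Q T' ?m"
      unfolding C_def \<psi>_def Q_def T'_def by (rule code_law_return(1)[OF P sets_P \<phi> h])
    have m: "?m \<in> Q \<rightarrow>\<^sub>M T'"
      unfolding Q_def T'_def by (rule code_law_return(2)[OF P sets_P \<phi> h])
    let ?bad = "{p \<in> space T'. \<not> met (fst p) (fst (snd p)) (snd (snd (snd p)))}"
    have "Measurable.pred T' (\<lambda>p. met (fst p) (fst (snd p)) (snd (snd (snd p))))"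
      unfolding T'_def by (rule met_measurable) measurable
    then have bad: "?bad \<in> sets T'" by measurable
    have "\<epsilon> = measure C ?bad"
      unfolding \<epsilon>_def by (rule arg_cong[where f = "measure C"]) (auto simp: C met_def ex)
    also have "\<dots> = measure Q (?m -` ?bad \<inter> space Q)"
      unfolding C by (rule measure_distr[OF m bad])
    also have "?m -` ?bad \<inter> space Q = space Q - good"
      using measurable_space[OF m] measurable_space[OF dec_meas]
      by (auto simp: good_def G_def h_def \<xi>_def \<eta>_def space_pair_measure)
    also have "measure Q \<dots> = 1 - measure Q good" by (rule Q.prob_compl) fact
    finally show ?thesis .
  qed
  have v_meas [measurable]: "v \<in> borel_measurable (Q \<Otimes>\<^sub>M Us)"
  proof -
    have [measurable]: "cond_RN_deriv Us (seq_space n X) PUX \<in> borel_measurable (Us \<Otimes>\<^sub>M seq_space n X)"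
      using cond_RN_deriv_kernel_law(1)[OF Q.prob_space_axioms K\<xi> \<xi>, folded L_def, folded PU PUX, folded PX, OF acX] .
    have [measurable]: "cond_RN_deriv Us (seq_space n Y) PUY \<in> borel_measurable (Us \<Otimes>\<^sub>M seq_space n Y)"
      using cond_RN_deriv_kernel_law(1)[OF Q.prob_space_axioms K\<xi> \<eta>, folded L_def, folded PU PUY, folded PY, OF acY] .
    show ?thesis unfolding v_def iX_def iY_def info_density_def by measurable
  qed
  define I where "I p = indicator G p * v p" for p
  have I_meas [measurable]: "I \<in> borel_measurable (Q \<Otimes>\<^sub>M Us)" unfolding I_def by measurable
  have I01: "0 \<le> I p" "I p \<le> 1" for p using v01[of p] by (auto simp: I_def indicator_def)
  have int_I: "integrable L I"
    by (rule L.integrable_const_bound[of _ 1]) (use I01 in auto)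
  \<comment> \<open>The matching bound is stated for nonnegative integrals; boundedness of
    \<open>I\<close> brings it back to real expectations.\<close>
  have "ennreal (\<integral>p. I p \<partial>L) = (\<integral>\<^sup>+ p. ennreal (I p) \<partial>L)"
    using int_I I01 by (simp add: nn_integral_eq_integral)
  also have "\<dots> = (\<integral>\<^sup>+ p. indicator G p * ennreal (v p) \<partial>L)"
    by (intro nn_integral_cong) (simp add: I_def indicator_def)
  also have "\<dots> \<le> ennreal (measure Q good)"
    using succ unfolding good_def[symmetric] by (simp add: Q.emeasure_eq_measure)
  finally have I_le: "(\<integral>p. I p \<partial>L) \<le> measure Q good" by (simp add: ennreal_le_iff)
  let ?F = "\<lambda>(s, x, y, u). (case g (u, y) of (sh, xh) \<Rightarrow>
              1 - of_bool (meets (seq_dist n ds s sh) Ds \<and> meets (seq_dist n d x xh) D)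
                * inverse (1 + inverse (real M) *
                    2 powr (info_density Us (seq_space n X) PUX u x
                              - info_density Us (seq_space n Y) PUY u y)))"
  define b where "b = (\<lambda>q :: (nat \<Rightarrow> 's) \<times> (nat \<Rightarrow> 'x) \<times> (nat \<Rightarrow> 'y) \<times> (nat \<Rightarrow> 'u).
    ((fst q, fst (snd q), fst (snd (snd q))), snd (snd (snd q))))"
  have b [measurable]: "b \<in> T \<rightarrow>\<^sub>M Q \<Otimes>\<^sub>M Us" unfolding b_def T_def by measurable
  have "(\<integral>q. ?F q \<partial>J) = (\<integral>q. 1 - I (b q) \<partial>J)"
  proof (rule Bochner_Integration.integral_cong[OF refl])
    fix q assume "q \<in> space J"
    then have "b q \<in> space (Q \<Otimes>\<^sub>M Us)" using measurable_space[OF b] by (simp add: J)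
    then show "?F q = 1 - I (b q)"
      by (auto simp: I_def G_def v_def met_def b_def \<xi>_def \<eta>_def iX_def iY_def indicator_def split_beta')
  qed
  also have "\<dots> = (\<integral>p. 1 - I (b (a p)) \<partial>L)"
    unfolding J by (rule integral_distr[OF a]) measurable
  also have "\<dots> = (\<integral>p. 1 - I p \<partial>L)" by (simp add: a_def b_def)
  also have "\<dots> = 1 - (\<integral>p. I p \<partial>L)" using int_I by (simp add: L.prob_space)
  finally have "\<epsilon> \<le> (\<integral>q. ?F q \<partial>J)" using \<epsilon> I_le by simp
  moreover have "wyner_ziv_code exceeds S X Y Sh Xh P ds d n M D Ds \<epsilon> \<phi> \<psi>"
    unfolding wyner_ziv_code_def using \<phi> \<psi> by (simp add: \<epsilon>_def C_def)
  ultimately show ?thesis by blast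
qed

end
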